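(* Let $\alpha\in\mathbb{R}$ and $\beta\in\mathbb{C}$ be such that $0<\alpha<|\beta|<1$, and suppose that the univalent (holomorphic and injective) function $h:\Delta\to\mathbb{C}$ satisfies $\beta h(\Delta)\subseteq h(\Delta)$. Given a point $x_0\in\Delta$, define the point $x_1=h^{-1}(\beta h(x_0))\in\Delta$ and the set $$\Omega_\alpha:=\left\{x\in\Delta:\ \alpha\,|h'(x_0)|(1-|x_0|^2)<|h'(x)|(1-|x|^2)\right\}.$$ Then the image $h(\Omega_\alpha)$ covers (contains) the open disk centered at $h(x_1)=\beta h(x_0)$ of radius $$\frac{|\beta|-\alpha}{4|\beta|}\,|h'(x_1)|(1-|x_1|^2),$$ and this radius is not less than $R=\dfrac{|\beta|-\alpha}{4}\,|h'(x_0)|(1-|x_0|^2)$.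
   Context: $\Delta=\{z\in\mathbb{C}:|z|<1\}$. The function $h$ is not assumed to be normalized. *)

theory Defs
  imports "HOL-Complex_Analysis.Complex_Analysis"
begin

abbreviation unit_disk :: "complex set" where
  "unit_disk \<equiv> ball 0 1"

definition univalent_on :: "(complex \<Rightarrow> complex) \<Rightarrow> complex set \<Rightarrow> bool" where
  "univalent_on h S \<longleftrightarrow> h holomorphic_on S \<and> inj_on h S"

definition Omega :: "(complex \<Rightarrow> complex) \<Rightarrow> complex \<Rightarrow> real \<Rightarrow> complex set" where
  "Omega h x\<^sub>0 \<alpha> =
     {x \<in> unit_disk. \<alpha> * cmod (deriv h x\<^sub>0) * (1 - (cmod x\<^sub>0)\<^sup>2) < cmod (deriv h x) * (1 - (cmod x)\<^sup>2)}"

end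

theory Submission
  imports Defs
begin

text \<open>Write \<open>\<rho>(z) = \<bar>h'(z)\<bar> (1 - \<bar>z\<bar>\<^sup>2)\<close> for the conformal radius of \<open>h(\<Delta>)\<close> at \<open>h(z)\<close>. The Schwarz--Pick
  lemma applied to \<open>h\<^sup>-\<^sup>1 \<circ> \<beta>h\<close> gives \<open>\<rho>(x\<^sub>1) \<ge> \<bar>\<beta>\<bar> \<rho>(x\<^sub>0)\<close>, which is the comparison of the radii. Koebe's
  quarter theorem puts the disc of radius \<open>\<rho>(x\<^sub>1)/4\<close> around \<open>h(x\<^sub>1)\<close> into \<open>h(\<Delta>)\<close>, and Bieberbach's
  bound on the second coefficient says that the conformal radius, as a function of the image
  point, is Lipschitz with constant 4. Hence at distance less than
  \<open>(1 - \<alpha>/\<bar>\<beta>\<bar>) \<rho>(x\<^sub>1)/4\<close> from \<open>h(x\<^sub>1)\<close> it exceeds \<open>\<alpha>/\<bar>\<beta>\<bar> \<rho>(x\<^sub>1) \<ge> \<alpha> \<rho>(x\<^sub>0)\<close>.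

  Bieberbach's bound rests on the area theorem for \<open>G(z) = 1/z + bz + O(z\<^sup>2)\<close>. To avoid Jordan curves
  and Green's formula, compose \<open>G\<close> with the real-linear map \<open>w \<mapsto> w - b r\<^sup>2 cnj w\<close>, which turns the
  near-ellipse \<open>G(\<bar>z\<bar> = r)\<close> into a near-circle of radius \<open>1/r + O(r\<^sup>2)\<close>. The image of the annulus
  \<open>r < \<bar>z\<bar> < s\<close> lies inside that circle, so its area, computed by change of variables through the
  exponential map, is at most \<open>\<pi> (1/r + O(r\<^sup>2))\<^sup>2\<close>; let \<open>r \<rightarrow> 0\<close> and then \<open>s \<rightarrow> 1\<close>.\<close>

no_notation fps_nth (infixl "$" 75)

section \<open>Area of the image of a rectangle\<close>

text \<open>The library states the change of variables theorem only for \<open>real^'n\<close>, hence this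
  identification of the complex plane with \<open>real^2\<close>.\<close>

definition cvec :: "real^2 \<Rightarrow> complex" where "cvec v = Complex (v$1) (v$2)"
definition vecc :: "complex \<Rightarrow> real^2" where "vecc z = vector [Re z, Im z]"

lemma cvec_vecc [simp]: "cvec (vecc z) = z"
  by (simp add: cvec_def vecc_def)

lemma vecc_cvec [simp]: "vecc (cvec v) = v"
  by (simp add: cvec_def vecc_def vec_eq_iff forall_2)

lemma norm_vecc: "norm (vecc z) = cmod z"
  by (simp add: vecc_def norm_vec_def L2_set_def sum_2 cmod_def)

lemma bounded_linear_cvec: "bounded_linear cvec"
  by (intro bounded_linear_intro[where K=1])
     (auto simp: cvec_def complex_eq_iff norm_vec_def L2_set_def sum_2 cmod_def)

lemma bounded_linear_vecc: "bounded_linear vecc"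
  by (intro bounded_linear_intro[where K=1])
     (auto simp: vec_eq_iff forall_2 norm_vecc, auto simp: vecc_def)

lemma image_vecc_box: "vecc ` box a b = box (vecc a) (vecc b)"
proof -
  have "v \<in> vecc ` box a b \<longleftrightarrow> v \<in> box (vecc a) (vecc b)" for v
  proof -
    have "v \<in> vecc ` box a b \<longleftrightarrow> cvec v \<in> box a b"
      by (metis cvec_vecc image_iff vecc_cvec)
    also have "\<dots> \<longleftrightarrow> v \<in> box (vecc a) (vecc b)"
      by (auto simp: in_box_complex_iff mem_box_cart forall_2 vecc_def cvec_def)
    finally show ?thesis .
  qed
  then show ?thesis by blast
qed

text \<open>Fubini in \<open>real^2\<close>: the coordinate map onto
  \<open>real \<times> real\<close> and its inverse carry boxes to boxes of the same content, so the
  integral transfers to the product, where it can be iterated.\<close>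

lemma integral_cbox_cart2:
  fixes f :: "real^2 \<Rightarrow> real"
  assumes "continuous_on (cbox u v) f"
  shows "integral (cbox u v) f =
    integral {u$1..v$1} (\<lambda>x. integral {u$2..v$2} (\<lambda>y. f (vector [x, y])))"
proof -
  define g :: "real \<times> real \<Rightarrow> real^2" where "g = (\<lambda>(x,y). vector [x,y])"
  define h :: "real^2 \<Rightarrow> real \<times> real" where "h = (\<lambda>v. (v$1, v$2))"
  have hg: "h (g x) = x" for x by (cases x) (simp add: h_def g_def)
  have gh: "g (h x) = x" for x by (auto simp: h_def g_def vec_eq_iff forall_2)
  have img: "g ` cbox (p :: real \<times> real) q = cbox (g p) (g q)" for p q
  proof -
    have "w \<in> g ` cbox p q \<longleftrightarrow> h w \<in> cbox p q" for w by (metis gh hg image_iff)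
    moreover have "h w \<in> cbox p q \<longleftrightarrow> w \<in> cbox (g p) (g q)" for w
      by (cases p; cases q) (auto simp: h_def g_def mem_box_cart forall_2 cbox_Pair_eq)
    ultimately show ?thesis by blast
  qed
  have imh: "h ` cbox p q = cbox (h p) (h q)" for p q
  proof -
    have "w \<in> h ` cbox p q \<longleftrightarrow> g w \<in> cbox p q" for w by (metis gh hg image_iff)
    moreover have "g w \<in> cbox p q \<longleftrightarrow> w \<in> cbox (h p) (h q)" for w
      by (cases w) (auto simp: h_def g_def mem_box_cart forall_2 cbox_Pair_eq)
    ultimately show ?thesis by blast
  qed
  have cg: "isCont g x" for x
  proof -
    have "bounded_linear g"
      by (intro bounded_linear_intro[where K=1])
         (auto simp: g_def vec_eq_iff forall_2 norm_vec_def L2_set_def sum_2 norm_Pair)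
    then show ?thesis by (simp add: linear_continuous_at)
  qed
  have co: "measure lborel (g ` cbox p q) = 1 * measure lborel (cbox p q)" for p q
  proof (cases "cbox p q = {}")
    case True then show ?thesis by simp
  next
    case False
    obtain p1 p2 q1 q2 where pq: "p = (p1,p2)" "q = (q1,q2)" by fastforce
    have le: "p1 \<le> q1" "p2 \<le> q2" using False by (auto simp: pq cbox_Pair_eq)
    have "cbox (g p) (g q) \<noteq> {}" using False img by (metis image_is_empty)
    then have "measure lborel (cbox (g p) (g q)) = (q1-p1)*(q2-p2)"
      by (subst content_cbox_cart) (auto simp: pq g_def UNIV_2)
    moreover have "measure lborel (cbox p q) = (q1-p1)*(q2-p2)"
      using le by (simp add: pq content_Pair)
    ultimately show ?thesis by (simp add: img)
  qed
  have "(f has_integral integral (cbox u v) f) (cbox u v)"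
    using assms by (simp add: integrable_continuous integrable_integral)
  moreover have "\<exists>w z. g ` cbox p q = cbox w z" "\<exists>w z. h ` cbox p' q' = cbox w z" for p q p' q'
    using img imh by blast+
  ultimately have "((\<lambda>x. f (g x)) has_integral (1 / 1) *\<^sub>R integral (cbox u v) f) (h ` cbox u v)"
    by (intro has_integral_twiddle[OF _ hg gh cg _ _ co]) auto
  then have "((\<lambda>x. f (g x)) has_integral integral (cbox u v) f) (h ` cbox u v)"
    by simp
  then have "integral (cbox u v) f = integral (cbox (h u) (h v)) (\<lambda>x. f (g x))"
    by (simp add: imh integral_unique)
  also have "\<dots> = integral {u$1..v$1} (\<lambda>x. integral {u$2..v$2} (\<lambda>y. f (g (x, y))))"
  proof -
    have "continuous_on (cbox (h u) (h v)) (\<lambda>x. f (g x))"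
    proof (rule continuous_on_compose2[OF assms])
      show "continuous_on (cbox (h u) (h v)) g" using cg by (simp add: continuous_at_imp_continuous_on)
      show "g ` cbox (h u) (h v) \<subseteq> cbox u v" by (simp add: img gh)
    qed
    then show ?thesis
      using integral_prod_continuous[of "u$1" "u$2" "v$1" "v$2" "\<lambda>x. f (g x)"]
      by (simp add: h_def cbox_interval)
  qed
  finally show ?thesis by (simp add: g_def)
qed

text \<open>Change of variables for the constant 1 turns the integral of the Jacobian over the open
  box into the area of the image, which lies in a disc. The constant is \<open>vec 1\<close> in
  \<open>real^1\<close> because the formula concerns vector-valued integrands; continuity of
  \<open>J\<close> on the closed box supplies integrability.\<close>

lemma integral_le_area:
  fixes F :: "real^2 \<Rightarrow> real^2" and R :: real
  assumes inj: "inj_on F (box u v)"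
    and der: "\<And>x. x \<in> box u v \<Longrightarrow> (F has_derivative F' x) (at x)"
    and det: "\<And>x. x \<in> box u v \<Longrightarrow> \<bar>det (matrix (F' x))\<bar> = J x"
    and J: "continuous_on (cbox u v) J"
    and img: "F ` box u v \<subseteq> cball 0 R" and "R \<ge> 0"
  shows "integral (cbox u v) J \<le> pi * R\<^sup>2"
proof -
  let ?one = "\<lambda>_::real^2. (vec 1 :: real^1)"
  have J0: "J x \<ge> 0" if "x \<in> box u v" for x using det[OF that] by linarith
  have Jint: "J integrable_on box u v"
    using J integrable_continuous integrable_on_open_interval by blast
  then have Jabs: "J absolutely_integrable_on box u v"
    using J0 by (simp add: absolutely_integrable_on_iff_nonneg)
  have "(\<lambda>x. J x *\<^sub>R (vec 1 :: real^1)) absolutely_integrable_on box u v"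
    by (intro absolutely_integrable_linear[OF Jabs, unfolded o_def] bounded_linear_scaleR_left)
  then have abs: "(\<lambda>x. \<bar>det (matrix (F' x))\<bar> *\<^sub>R ?one (F x)) absolutely_integrable_on box u v"
    by (rule set_integrable_cong[THEN iffD1, rotated -1]) (auto simp: det)
  have lb: "box u v \<in> sets lebesgue" by simp
  have cv: "?one absolutely_integrable_on F ` box u v \<and>
        integral (F ` box u v) ?one = integral (box u v) (\<lambda>x. \<bar>det (matrix (F' x))\<bar> *\<^sub>R ?one (F x))"
    using has_absolute_integral_change_of_variables[OF lb has_derivative_at_withinI[OF der] inj, of "?one"] abs
    by blast
  then have i1: "?one integrable_on F ` box u v"
    using set_lebesgue_integral_eq_integral(1) by blast
  have i2: "?one integrable_on cball 0 R"
    by (intro integrable_on_const) simp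
  have "integral (box u v) J = integral (box u v) (\<lambda>x. \<bar>det (matrix (F' x))\<bar> *\<^sub>R ?one (F x)) $ 1"
  proof -
    have "integral (box u v) (\<lambda>x. \<bar>det (matrix (F' x))\<bar> *\<^sub>R ?one (F x)) = integral (box u v) (\<lambda>x. J x *\<^sub>R (vec 1 :: real^1))"
      by (intro integral_cong) (simp add: det)
    also have "\<dots> = integral (box u v) J *\<^sub>R vec 1"
      by (intro integral_unique has_integral_scaleR_left integrable_integral Jint)
    finally show ?thesis by simp
  qed
  also have "\<dots> = integral (F ` box u v) ?one $ 1" using cv by simp
  also have "\<dots> \<le> integral (cball 0 R) ?one $ 1"
    using integral_subset_component_le[OF _ img i1 i2, of "axis 1 1"]
    by (simp add: inner_axis axis_in_Basis_iff)
  also have "\<dots> = measure lebesgue (cball (0::real^2) R)"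
  proof -
    have "((\<lambda>x. 1 :: real) has_integral integral (cball (0::real^2) R) (\<lambda>x. 1)) (cball (0::real^2) R)"
      using integrable_on_const[of "cball (0::real^2) R" "1::real"] by (auto intro: integrable_integral)
    from has_integral_scaleR_left[OF this, of "vec 1 :: real^1"]
    have "integral (cball (0::real^2) R) ?one = integral (cball (0::real^2) R) (\<lambda>x. 1 :: real) *\<^sub>R vec 1"
      by (simp add: integral_unique)
    moreover have "measure lebesgue (cball (0::real^2) R) = integral (cball (0::real^2) R) (\<lambda>x. 1 :: real)"
      by (rule lmeasure_integral) simp
    ultimately show ?thesis by simp
  qed
  also have "\<dots> = pi * R\<^sup>2" using \<open>R \<ge> 0\<close>
    by (simp add: content_cball unit_ball_vol_2)
  finally show ?thesis
    by (simp add: integral_open_interval)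
qed

text \<open>The derivative is multiplication by \<open>l z\<close>, of determinant |l z|^2, followed
  by \<open>w \<mapsto> w - c * cnj w\<close>, of determinant 1 - |c|^2. The Jacobian is the product
  of the two.\<close>

lemma integral_rectangle_le_area:
  fixes M l :: "complex \<Rightarrow> complex" and c :: complex and R :: real
  assumes inj: "inj_on M (box a b)"
    and der: "\<And>z. z \<in> box a b \<Longrightarrow> (M has_derivative (\<lambda>v. l z * v - c * cnj (l z * v))) (at z)"
    and "cmod c < 1" and cont: "continuous_on (cbox a b) l"
    and img: "M ` box a b \<subseteq> cball 0 R" and "R \<ge> 0"
  shows "(1 - (cmod c)\<^sup>2) * integral {Re a..Re b} (\<lambda>x. integral {Im a..Im b} (\<lambda>y. (cmod (l (Complex x y)))\<^sup>2))
    \<le> pi * R\<^sup>2"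
proof -
  define F where "F = (\<lambda>v. vecc (M (cvec v)))"
  define F' where "F' = (\<lambda>v u. vecc (l (cvec v) * cvec u - c * cnj (l (cvec v) * cvec u)))"
  define J where "J = (\<lambda>v. (1 - (cmod c)\<^sup>2) * (cmod (l (cvec v)))\<^sup>2)"
  let ?B = "box (vecc a) (vecc b)"
  have mem: "cvec v \<in> box a b" if "v \<in> ?B" for v
    using that unfolding image_vecc_box[symmetric] by auto
  have cmem: "cvec v \<in> cbox a b" if "v \<in> cbox (vecc a) (vecc b)" for v
    using that by (auto simp: in_cbox_complex_iff mem_box_cart forall_2 vecc_def cvec_def)
  have Finj: "inj_on F ?B"
    unfolding inj_on_def F_def by (metis mem inj inj_onD cvec_vecc vecc_cvec)
  have Fder: "(F has_derivative F' v) (at v)" if "v \<in> ?B" for v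
  proof -
    have "((\<lambda>v. M (cvec v)) has_derivative (\<lambda>u. l (cvec v) * cvec u - c * cnj (l (cvec v) * cvec u))) (at v)"
      by (rule has_derivative_compose[OF bounded_linear_imp_has_derivative[OF bounded_linear_cvec] der[OF mem[OF that]]])
    from bounded_linear.has_derivative[OF bounded_linear_vecc this]
    show ?thesis by (simp add: F_def F'_def)
  qed
  have Fdet: "\<bar>det (matrix (F' v))\<bar> = J v" for v
  proof -
    \<comment> \<open>The columns of the matrix are the images of 1 and i.\<close>
    have ax: "cvec (axis 1 1) = 1" "cvec (axis 2 1) = \<i>"
      by (auto simp: cvec_def axis_def complex_eq_iff)
    have "det (matrix (F' v)) = J v"
      by (simp add: det_2 matrix_def F'_def ax vecc_def J_def cmod_power2)
         (simp add: power2_eq_square algebra_simps)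
    moreover have "J v \<ge> 0"
      using \<open>cmod c < 1\<close> by (simp add: J_def power_le_one)
    ultimately show ?thesis by simp
  qed
  have "continuous_on (cbox (vecc a) (vecc b)) (\<lambda>v. l (cvec v))"
    by (rule continuous_on_compose2[OF cont linear_continuous_on[OF bounded_linear_cvec]]) (auto simp: cmem)
  then have Jc: "continuous_on (cbox (vecc a) (vecc b)) J"
    unfolding J_def by (intro continuous_intros)
  have Fimg: "F ` ?B \<subseteq> cball 0 R"
    using img mem by (auto simp: F_def norm_vecc image_subset_iff)
  have "integral (cbox (vecc a) (vecc b)) J \<le> pi * R\<^sup>2"
    by (rule integral_le_area[OF Finj Fder Fdet Jc Fimg \<open>R \<ge> 0\<close>])
  also have "integral (cbox (vecc a) (vecc b)) J = 
     integral {Re a..Re b} (\<lambda>x. integral {Im a..Im b} (\<lambda>y. J (vector [x, y])))"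
    using integral_cbox_cart2[OF Jc] by (simp add: vecc_def)
  finally show ?thesis by (simp add: J_def cvec_def)
qed

section \<open>The area theorem\<close>

text \<open>Cauchy's integral formula at 0 for the circle of radius \<open>exp x\<close>. The circle
  is written through \<open>exp\<close> to match the logarithmic coordinates of the area
  integral.\<close>

lemma Re_circle_mean:
  assumes p: "p holomorphic_on ball 0 1" and "cmod (exp (complex_of_real x)) < 1"
  shows "((\<lambda>y. Re (p (exp (Complex x y)))) has_integral 2 * pi * Re (p 0)) {0..2*pi}"
proof -
  let ?r = "exp x"
  have r: "0 < ?r" "?r < 1" using assms(2) by auto
  have "((\<lambda>u. p u / (u - 0)) has_contour_integral (2 * of_real pi * \<i> * p 0)) (circlepath 0 ?r)"
  proof (rule Cauchy_integral_circlepath)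
    have "cball 0 ?r \<subseteq> ball (0::complex) 1" using r by (simp add: cball_subset_ball_iff)
    then have "p holomorphic_on cball 0 ?r" using p holomorphic_on_subset by blast
    then show "continuous_on (cball 0 ?r) p" "p holomorphic_on ball 0 ?r"
      using holomorphic_on_imp_continuous_on holomorphic_on_subset ball_subset_cball by blast+
  qed (use r in auto)
  then have "((\<lambda>t. p (exp x * cis t) / (exp x * cis t) * exp x * \<i> * cis t) has_integral (2 * of_real pi * \<i> * p 0)) {0..2*pi}"
    unfolding circlepath_def by (subst (asm) has_contour_integral_part_circlepath_iff) auto
  then have "((\<lambda>t. \<i> * p (exp x * cis t)) has_integral (2 * of_real pi * \<i> * p 0)) {0..2*pi}"
    by (rule has_integral_eq[rotated]) (simp add: field_simps)
  from has_integral_mult_right[OF this, of "-\<i>"]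
  have "((\<lambda>t. p (exp x * cis t)) has_integral (- \<i> * (2 * of_real pi * \<i> * p 0))) {0..2*pi}"
    by simp
  moreover have "- \<i> * (2 * of_real pi * \<i> * p 0) = 2 * pi * p 0"
    by (simp add: algebra_simps)
  ultimately have "((\<lambda>t. p (exp x * cis t)) has_integral (2 * pi * p 0)) {0..2*pi}"
    by (simp only:)
  from has_integral_Re[OF this]
  show ?thesis
    by (simp add: Complex_eq exp_add cis_conv_exp exp_of_real mult_ac)
qed

text \<open>\<open>G\<close> maps the punctured disc of radius \<open>r\<close> onto a set containing the connected set \<open>-V\<close>, because
  the image is open, relatively closed in \<open>-V\<close> and contains all points near infinity. Injectivity
  then leaves only \<open>V\<close> for the other points.\<close>
lemma annulus_image_subset_convex:
  fixes G :: "complex \<Rightarrow> complex"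
  assumes hol: "G holomorphic_on ball 0 1 - {0}" and inj: "inj_on G (ball 0 1 - {0})"
    and pole: "filterlim G at_infinity (at 0)"
    and V: "closed V" "bounded V" "convex V" and "0 < r" "r < 1"
    and sph: "G ` sphere 0 r \<subseteq> V" and z: "r < cmod z" "cmod z < 1"
  shows "G z \<in> V"
proof (rule ccontr)
  assume "G z \<notin> V"
  define W where "W = G ` (ball 0 r - {0})"
  \<comment> \<open>Because of the pole, preimages of a bounded set stay away from 0.\<close>
  have large: "\<exists>\<delta>>0. \<delta> < r \<and> (\<forall>u. 0 < cmod u \<and> cmod u < \<delta> \<longrightarrow> B < cmod (G u))" for B
  proof -
    have "eventually (\<lambda>u. B < cmod (G u)) (at 0)"
      using pole unfolding filterlim_at_infinity_conv_norm_at_top filterlim_at_top_dense by blast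
    then obtain d where "d > 0" "\<And>u. u \<noteq> 0 \<Longrightarrow> dist u 0 < d \<Longrightarrow> B < cmod (G u)"
      unfolding eventually_at by auto
    then show ?thesis
      using \<open>0 < r\<close> by (intro exI[of _ "min d (r/2)"]) auto
  qed
  have sub: "ball 0 r - {0} \<subseteq> ball 0 1 - {0::complex}" using \<open>r < 1\<close> by auto
  have "open W"
    unfolding W_def
    by (rule open_mapping_thm3[OF holomorphic_on_subset[OF hol sub]])
       (auto intro: inj_on_subset[OF inj sub])
  \<comment> \<open>Values in \<open>W\<close> near \<open>w\<close> come from the compact annulus
    \<open>K\<close>, so \<open>w\<close> has a preimage there. That preimage is not on the outer
    circle, which is mapped into \<open>V\<close>.\<close>
  have clW: "w \<in> W" if w: "w \<in> closure W" "w \<notin> V" for w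
  proof -
    obtain \<delta> where d: "\<delta> > 0" "\<delta> < r" "\<And>u. 0 < cmod u \<Longrightarrow> cmod u < \<delta> \<Longrightarrow> cmod w + 1 < cmod (G u)"
      using large[of "cmod w + 1"] by blast
    define K where "K = cball 0 r - ball (0::complex) \<delta>"
    have "compact K" unfolding K_def by (intro compact_diff) auto
    moreover have "continuous_on K G"
      using d \<open>r < 1\<close> by (intro holomorphic_on_imp_continuous_on holomorphic_on_subset[OF hol]) (auto simp: K_def)
    ultimately have "closed (G ` K)"
      by (intro compact_imp_closed compact_continuous_image)
    have "w \<in> closure (W \<inter> ball w 1)"
      using w open_Int_closure_subset[of "ball w 1" W] by (auto simp: Int_commute)
    moreover have "W \<inter> ball w 1 \<subseteq> G ` K"
    proof
      fix y assume y: "y \<in> W \<inter> ball w 1"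
      then obtain u where u: "u \<in> ball 0 r - {0}" "y = G u" unfolding W_def by blast
      have "cmod (G u) < cmod w + 1"
        using y u norm_triangle_ineq2[of "G u" w] by (auto simp: dist_norm norm_minus_commute)
      then have "cmod u \<ge> \<delta>" using d(3)[of u] u by force
      then show "y \<in> G ` K" using u by (auto simp: K_def)
    qed
    ultimately have "w \<in> G ` K"
      using \<open>closed (G ` K)\<close> closure_minimal by blast
    then obtain u where u: "u \<in> K" "w = G u" by auto
    then have "cmod u \<noteq> r" using sph \<open>w \<notin> V\<close> by (metis image_subset_iff mem_sphere_0)
    then have "u \<in> ball 0 r - {0}" using u d by (auto simp: K_def)
    then show ?thesis using u by (auto simp: W_def)
  qed
  have "connected (- V)"
    using V by (intro connected_complement_bounded_convex) auto
  moreover have "W \<inter> - V \<noteq> {}"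
  proof -
    obtain B where B: "\<And>v. v \<in> V \<Longrightarrow> cmod v \<le> B" using \<open>bounded V\<close> unfolding bounded_iff by blast
    obtain \<delta> where d: "\<delta> > 0" "\<delta> < r" "\<And>u. 0 < cmod u \<Longrightarrow> cmod u < \<delta> \<Longrightarrow> B < cmod (G u)"
      using large[of B] by blast
    have "B < cmod (G (of_real (\<delta>/2)))" using d(1) by (intro d(3)) auto
    then have "G (of_real (\<delta>/2)) \<notin> V" using B by force
    moreover have "G (of_real (\<delta>/2)) \<in> W" using d unfolding W_def by (intro imageI) auto
    ultimately show ?thesis by blast
  qed
  moreover have "- V \<subseteq> W \<union> - closure W" using clW by blast
  moreover have "W \<inter> - closure W \<inter> - V = {}" using closure_subset by blast
  ultimately have "- closure W \<inter> - V = {}"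
    using connectedD[of "- V" W "- closure W"] \<open>open W\<close> by (auto simp: open_Compl)
  then have "G z \<in> W" using \<open>G z \<notin> V\<close> clW by blast
  then obtain u where u: "u \<in> ball 0 r - {0}" "G z = G u" unfolding W_def by blast
  have "z \<in> ball 0 1 - {0}" using z \<open>0 < r\<close> by auto
  then have "z = u" using inj_onD[OF inj u(2)] u(1) sub by blast
  then show False using z u by auto
qed

text \<open>The passage to the limit \<open>r \<rightarrow> 0\<close> in the area inequality, where
  \<beta> stands for |b|^2. The terms 1/r^2 on both sides cancel, and what survives at r = 0 is
  \<open>\<beta> * s^2 \<le> 1/s^2\<close>.\<close>

lemma area_limit_bound:
  fixes \<beta> C s d :: real
  assumes "0 < s" "0 < d" "\<And>r. 0 < r \<Longrightarrow> r < d \<Longrightarrow>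
     (1 - \<beta> * r^4) * ((1/r^2 - 1/s^2) + \<beta> * (s^2 - r^2)) \<le> (1/r + C * r^2)^2"
  shows "\<beta> * s^4 \<le> 1"
proof -
  define D where "D = (\<lambda>r. (1 - \<beta> * r^4) * ((1/r^2 - 1/s^2) + \<beta> * (s^2 - r^2)) - (1/r + C * r^2)^2)"
  \<comment> \<open>\<open>E\<close> is \<open>D\<close> multiplied out after the cancellation of
    1/r^2: a polynomial in \<open>r\<close>, hence continuous at 0.\<close>
  define E where "E = (\<lambda>r. -1/s^2 + \<beta> * s^2 - \<beta> * r^2 - \<beta> * r^2 + \<beta> * r^4*(1/s^2) - \<beta> * r^4*\<beta>*(s^2-r^2) - 2*C*r - C^2*r^4)"
  have DE: "D r = E r" if "r > 0" for r
    using that \<open>0 < s\<close> unfolding D_def E_def by (simp add: field_simps power2_eq_square power4_eq_xxxx)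
  have "(E \<longlongrightarrow> E 0) (at_right 0)"
    unfolding E_def by (intro tendsto_intros)
  moreover have "eventually (\<lambda>r. E r \<le> 0) (at_right 0)"
  proof -
    have "E r \<le> 0" if "0 < r" "r < d" for r
      using assms(3)[OF that] DE[OF that(1)] by (simp add: D_def)
    then show ?thesis
      unfolding eventually_at_right_field using \<open>0 < d\<close> by blast
  qed
  ultimately have "E 0 \<le> 0"
    by (intro tendsto_upperbound) auto
  then show ?thesis using \<open>0 < s\<close>
    by (simp add: E_def field_simps power2_eq_square power4_eq_xxxx)
qed

text \<open>With \<open>P = -1/e + be\<close> this is \<open>\<bar>P + m\<bar>\<^sup>2 \<ge> \<bar>P\<bar>\<^sup>2 + 2 Re (m cnj P)\<close>, where \<open>cnj e = \<rho>\<^sup>2/e\<close> makes the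
  mixed terms holomorphic in \<open>e\<close> and vanishing at 0, so that they have mean 0 on circles.\<close>
lemma annulus_pointwise:
  fixes e n b :: complex and \<rho> :: real
  assumes "cmod e = \<rho>" "\<rho> > 0"
  shows "1/\<rho>\<^sup>2 + (cmod b)\<^sup>2 * \<rho>\<^sup>2 + Re (- (2 / \<rho>\<^sup>2) * b * e\<^sup>2 - (2 / \<rho>\<^sup>2) * n * e^3 + 2 * \<rho>\<^sup>2 * cnj b * e * n)
     \<le> (cmod (- 1/e + b * e + e\<^sup>2 * n))\<^sup>2"
proof -
  have e0: "e \<noteq> 0" using assms by auto
  define P where "P = - 1/e + b * e"
  have ee: "e * cnj e = of_real (\<rho>\<^sup>2)" using complex_norm_square[of e] assms by simp
  have r0: "complex_of_real \<rho> \<noteq> 0" using assms by auto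
  have cP: "cnj P = - e / of_real (\<rho>\<^sup>2) + cnj b * of_real (\<rho>\<^sup>2) / e"
  proof -
    have "cnj e = of_real (\<rho>\<^sup>2) / e" using ee e0 by (simp add: field_simps)
    then show ?thesis using e0 r0 by (simp add: P_def)
  qed
  have "of_real ((cmod P)\<^sup>2) = P * cnj P" by (rule complex_norm_square)
  also have "\<dots> = 1 / of_real (\<rho>\<^sup>2) + b * cnj b * of_real (\<rho>\<^sup>2) - b * e\<^sup>2 / of_real (\<rho>\<^sup>2) - cnj b * of_real (\<rho>\<^sup>2) / e\<^sup>2"
    unfolding cP unfolding P_def using e0 r0 by (simp add: field_simps power2_eq_square)
  \<comment> \<open>The last two terms are conjugate to each other, so together they have twice the
    real part of the one that is holomorphic in \<open>e\<close>.\<close>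
  also have "cnj b * of_real (\<rho>\<^sup>2) / e\<^sup>2 = cnj (b * e\<^sup>2 / of_real (\<rho>\<^sup>2))"
  proof -
    have "cnj e = of_real (\<rho>\<^sup>2) / e" using ee e0 by (simp add: field_simps)
    then show ?thesis using e0 r0 by (simp add: field_simps power2_eq_square)
  qed
  finally have "Re (of_real ((cmod P)\<^sup>2)) = Re (1 / of_real (\<rho>\<^sup>2) + b * cnj b * of_real (\<rho>\<^sup>2) - b * e\<^sup>2 / of_real (\<rho>\<^sup>2) - cnj (b * e\<^sup>2 / of_real (\<rho>\<^sup>2)))"
    by (rule arg_cong)
  also have "1 / complex_of_real (\<rho>\<^sup>2) = of_real (1/\<rho>\<^sup>2)" by simp
  also have "b * cnj b * of_real (\<rho>\<^sup>2) = of_real ((cmod b)\<^sup>2 * \<rho>\<^sup>2)" by (simp add: complex_norm_square[symmetric] del: of_real_power)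
  finally have P2: "(cmod P)\<^sup>2 = 1/\<rho>\<^sup>2 + (cmod b)\<^sup>2 * \<rho>\<^sup>2 - 2 * Re (b * e\<^sup>2 / of_real (\<rho>\<^sup>2))"
    by (simp only: minus_complex.sel plus_complex.sel Re_complex_of_real cnj.sel)
  have "e\<^sup>2 * n * cnj P = - n * e^3 / of_real (\<rho>\<^sup>2) + cnj b * e * n * of_real (\<rho>\<^sup>2)"
    using e0 r0 by (simp add: cP field_simps power2_eq_square power3_eq_cube)
  then have m: "Re (e\<^sup>2 * n * cnj P) = Re (- n * e^3 / of_real (\<rho>\<^sup>2) + cnj b * e * n * of_real (\<rho>\<^sup>2))" by simp
  have "(cmod (P + e\<^sup>2 * n))\<^sup>2 = (cmod P)\<^sup>2 + (cmod (e\<^sup>2 * n))\<^sup>2 + 2 * Re (e\<^sup>2 * n * cnj P)"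
    unfolding cmod_power2 by (simp add: power2_eq_square algebra_simps)
  also have "\<dots> \<ge> (cmod P)\<^sup>2 + 2 * Re (e\<^sup>2 * n * cnj P)" by simp
  finally have "(cmod P)\<^sup>2 + 2 * Re (e\<^sup>2 * n * cnj P) \<le> (cmod (P + e\<^sup>2 * n))\<^sup>2" .
  moreover have "1/\<rho>\<^sup>2 + (cmod b)\<^sup>2 * \<rho>\<^sup>2 + Re (- (2 / \<rho>\<^sup>2) * b * e\<^sup>2 - (2 / \<rho>\<^sup>2) * n * e^3 + 2 * \<rho>\<^sup>2 * cnj b * e * n)
     = (cmod P)\<^sup>2 + 2 * Re (e\<^sup>2 * n * cnj P)"
  proof -
    have R2: "Re (of_real 2 * z) = 2 * Re z" for z by simp
    have "Re (- (2 / \<rho>\<^sup>2) * b * e\<^sup>2 - (2 / \<rho>\<^sup>2) * n * e^3 + 2 * \<rho>\<^sup>2 * cnj b * e * n)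
      = Re (of_real 2 * (- (b * e\<^sup>2 / of_real (\<rho>\<^sup>2)) + (- n * e^3 / of_real (\<rho>\<^sup>2) + cnj b * e * n * of_real (\<rho>\<^sup>2))))"
      by (intro arg_cong[where f=Re]) (simp add: field_simps)
    also have "\<dots> = 2 * (- Re (b * e\<^sup>2 / of_real (\<rho>\<^sup>2)) + Re (e\<^sup>2 * n * cnj P))"
      by (simp only: R2 m plus_complex.sel uminus_complex.sel)
    finally show ?thesis unfolding P2 by simp
  qed
  ultimately show ?thesis by (simp add: P_def)
qed

text \<open>For \<open>n z = 2 * k z + z * deriv k z\<close> the function \<open>l\<close> is the
  derivative of \<open>G \<circ> exp\<close>. The bound \<open>annulus_pointwise\<close> is
  integrated first over \<open>y\<close>, where the real part of \<open>q\<close> has mean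
  \<open>Re (q 0) = 0\<close>, and then over \<open>x\<close>, where only an elementary function of
  \<open>exp x\<close> remains.\<close>

lemma annulus_integral_lower_bound:
  fixes n :: "complex \<Rightarrow> complex"
  assumes n: "n holomorphic_on ball 0 1" and rs: "0 < r" "r < s" "s < 1"
    and l: "l = (\<lambda>z. - 1 / exp z + b * exp z + (exp z)\<^sup>2 * n (exp z))"
  shows "pi * ((1/r\<^sup>2 - 1/s\<^sup>2) + (cmod b)\<^sup>2 * (s\<^sup>2 - r\<^sup>2)) \<le>
    integral {ln r..ln s} (\<lambda>x. integral {0..2*pi} (\<lambda>y. (cmod (l (Complex x y)))\<^sup>2))"
    and "continuous_on (cbox (Complex (ln r) 0) (Complex (ln s) (2*pi))) l"
proof -
  define S where "S = {z. exp (Re z) < 1}"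
  have lc: "continuous_on S l"
    unfolding l
    by (intro continuous_intros continuous_on_compose2[OF holomorphic_on_imp_continuous_on[OF n]])
       (auto simp: S_def)
  have sm: "exp x < 1" if "x \<le> ln s" for x :: real
  proof -
    have "x < 0" using that rs ln_less_zero[of s] by linarith
    then show ?thesis by simp
  qed
  have sub: "Complex x y \<in> S" if "x \<in> {ln r..ln s}" for x y
    using sm that by (auto simp: S_def)
  show "continuous_on (cbox (Complex (ln r) 0) (Complex (ln s) (2*pi))) l"
    by (rule continuous_on_subset[OF lc]) (use sm in \<open>auto simp: S_def in_cbox_complex_iff\<close>)
  have cc: "continuous_on A (\<lambda>x. Complex (f x) (g x))" if "continuous_on A f" "continuous_on A g" for A :: "'a::topological_space set" and f g
    unfolding Complex_eq using that by (intro continuous_intros)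
  have inner: "2 * pi * (1/(exp x)\<^sup>2 + (cmod b)\<^sup>2 * (exp x)\<^sup>2) \<le> integral {0..2*pi} (\<lambda>y. (cmod (l (Complex x y)))\<^sup>2)"
    if x: "x \<in> {ln r..ln s}" for x
  proof -
    let ?\<rho> = "exp x"
    define q where "q = (\<lambda>e. - (2 / ?\<rho>\<^sup>2) * b * e\<^sup>2 - (2 / ?\<rho>\<^sup>2) * n e * e^3 + 2 * ?\<rho>\<^sup>2 * cnj b * e * n e)"
    have "q holomorphic_on ball 0 1" unfolding q_def by (intro holomorphic_intros n)
    then have "((\<lambda>y. Re (q (exp (Complex x y)))) has_integral 2 * pi * Re (q 0)) {0..2*pi}"
      using sm x by (intro Re_circle_mean) auto
    then have "((\<lambda>y. (1/?\<rho>\<^sup>2 + (cmod b)\<^sup>2 * ?\<rho>\<^sup>2) + Re (q (exp (Complex x y)))) has_integral 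
        (2*pi) *\<^sub>R (1/?\<rho>\<^sup>2 + (cmod b)\<^sup>2 * ?\<rho>\<^sup>2) + 2 * pi * Re (q 0)) {0..2*pi}"
      using has_integral_const_real[of "1/?\<rho>\<^sup>2 + (cmod b)\<^sup>2 * ?\<rho>\<^sup>2" 0 "2*pi"]
      by (intro has_integral_add) simp_all
    moreover have "((\<lambda>y. (cmod (l (Complex x y)))\<^sup>2) has_integral integral {0..2*pi} (\<lambda>y. (cmod (l (Complex x y)))\<^sup>2)) {0..2*pi}"
      by (intro integrable_integral integrable_continuous_real continuous_intros continuous_on_compose2[OF lc] cc)
         (use sub x in auto)
    ultimately have "(2*pi) *\<^sub>R (1/?\<rho>\<^sup>2 + (cmod b)\<^sup>2 * ?\<rho>\<^sup>2) + 2 * pi * Re (q 0) \<le> integral {0..2*pi} (\<lambda>y. (cmod (l (Complex x y)))\<^sup>2)"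
    proof (rule has_integral_le)
      fix y
      have "cmod (exp (Complex x y)) = ?\<rho>" by simp
      from annulus_pointwise[OF this, of b "n (exp (Complex x y))"]
      show "(1/?\<rho>\<^sup>2 + (cmod b)\<^sup>2 * ?\<rho>\<^sup>2) + Re (q (exp (Complex x y))) \<le> (cmod (l (Complex x y)))\<^sup>2"
        unfolding q_def l by simp
    qed
    then show ?thesis by (simp add: q_def)
  qed
  \<comment> \<open>An antiderivative in \<open>x\<close> is pi (-1/\<rho>^2 + |b|^2 \<rho>^2) with
    \<rho> = \<open>exp x\<close>.\<close>
  have "((\<lambda>x. 2 * pi * (1/(exp x)\<^sup>2 + (cmod b)\<^sup>2 * (exp x)\<^sup>2)) has_integral
     (pi * (- 1/(exp (ln s))\<^sup>2 + (cmod b)\<^sup>2 * (exp (ln s))\<^sup>2) - pi * (- 1/(exp (ln r))\<^sup>2 + (cmod b)\<^sup>2 * (exp (ln r))\<^sup>2))) {ln r..ln s}"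
    using rs
    by (intro fundamental_theorem_of_calculus)
       (auto intro!: derivative_eq_intros simp: has_real_derivative_iff_has_vector_derivative[symmetric] field_simps power2_eq_square)
  moreover have "((\<lambda>x. integral {0..2*pi} (\<lambda>y. (cmod (l (Complex x y)))\<^sup>2)) has_integral
      integral {ln r..ln s} (\<lambda>x. integral {0..2*pi} (\<lambda>y. (cmod (l (Complex x y)))\<^sup>2))) {ln r..ln s}"
  proof (intro integrable_integral integrable_continuous_real)
    have "continuous_on ({ln r..ln s} \<times> cbox 0 (2*pi)) (\<lambda>(x,y). (cmod (l (Complex x y)))\<^sup>2)"
      unfolding case_prod_unfold
      by (intro continuous_intros continuous_on_compose2[OF lc] cc) (use sub in auto)
    from integral_continuous_on_param[OF this]
    show "continuous_on {ln r..ln s} (\<lambda>x. integral {0..2*pi} (\<lambda>y. (cmod (l (Complex x y)))\<^sup>2))"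
      by simp
  qed
  ultimately have "(pi * (- 1/(exp (ln s))\<^sup>2 + (cmod b)\<^sup>2 * (exp (ln s))\<^sup>2) - pi * (- 1/(exp (ln r))\<^sup>2 + (cmod b)\<^sup>2 * (exp (ln r))\<^sup>2))
    \<le> integral {ln r..ln s} (\<lambda>x. integral {0..2*pi} (\<lambda>y. (cmod (l (Complex x y)))\<^sup>2))"
    by (rule has_integral_le) (use inner in auto)
  then show "pi * ((1/r\<^sup>2 - 1/s\<^sup>2) + (cmod b)\<^sup>2 * (s\<^sup>2 - r\<^sup>2)) \<le>
    integral {ln r..ln s} (\<lambda>x. integral {0..2*pi} (\<lambda>y. (cmod (l (Complex x y)))\<^sup>2))"
    using rs by (simp add: algebra_simps)
qed


text \<open>The Jacobian integral of T(G(exp z)) over a logarithmic rectangle is bounded below by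
  \<open>annulus_integral_lower_bound\<close> and above by the area of a disc of radius
  \<open>R\<close>.\<close>

lemma area_inequality:
  fixes k :: "complex \<Rightarrow> complex" and b :: complex
  defines "G \<equiv> (\<lambda>z. 1/z + b * z + z\<^sup>2 * k z)"
  assumes k: "k holomorphic_on ball 0 1" and inj: "inj_on G (ball 0 1 - {0})"
    and rs: "0 < r" "r < s" "s < 1" and B: "\<And>z. cmod z = r \<Longrightarrow> cmod (k z) \<le> B"
    and rb: "cmod b * r\<^sup>2 < 1"
  shows "(1 - (cmod b)\<^sup>2 * r^4) * ((1/r\<^sup>2 - 1/s\<^sup>2) + (cmod b)\<^sup>2 * (s\<^sup>2 - r\<^sup>2))
     \<le> (1/r + (B + (cmod b)\<^sup>2 + cmod b * B) * r\<^sup>2)\<^sup>2"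
proof -
  \<comment> \<open>On |z| = r one has r^2 cnj(1/z) = z, so this \<open>c\<close> makes
    \<open>c * cnj (1/z)\<close> cancel the term \<open>b * z\<close> of \<open>G\<close>.\<close>
  define c where "c = b * of_real (r\<^sup>2)"
  have c: "cmod c = cmod b * r\<^sup>2" "cmod c < 1" using rb by (simp_all add: c_def norm_mult norm_power)
  define T where "T = (\<lambda>w. w - c * cnj w)"
  have linT: "bounded_linear T"
    unfolding T_def
    by (intro bounded_linear_sub bounded_linear_ident bounded_linear_const_mult bounded_linear_cnj)
  \<comment> \<open>As |c| < 1, this lower bound yields both the injectivity of \<open>T\<close> and
    the boundedness of \<open>V\<close>.\<close>
  have Tlow: "(1 - cmod c) * cmod w \<le> cmod (T w)" for w
    using norm_triangle_ineq2[of w "c * cnj w"] by (simp add: T_def norm_mult algebra_simps)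
  have Tinj: "w = w'" if "T w = T w'" for w w'
  proof -
    have "T (w - w') = 0" using that linear_diff[OF bounded_linear.linear[OF linT]] by simp
    then have "(1 - cmod c) * cmod (w - w') \<le> 0" using Tlow[of "w - w'"] by simp
    then show ?thesis using c by (simp add: mult_le_0_iff)
  qed
  \<comment> \<open>The three terms in the bracket bound z^2 k(z), c cnj(bz) and c cnj(z^2 k(z)) on
    |z| = r, with surplus powers of r estimated by 1.\<close>
  define R where "R = 1/r + (B + (cmod b)\<^sup>2 + cmod b * B) * r\<^sup>2"
  \<comment> \<open>The linear preimage of the disc is closed, bounded and convex, as
    \<open>annulus_image_subset_convex\<close> demands. Enclosing the values of \<open>G\<close> in
    \<open>V\<close> encloses those of T(G) in the disc.\<close>
  define V where "V = T -` cball 0 R"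
  have B0: "B \<ge> 0" using B[of "of_real r"] rs norm_ge_zero order_trans by (metis abs_of_pos norm_of_real)
  have R0: "R \<ge> 0" unfolding R_def using rs B0 by (intro add_nonneg_nonneg mult_nonneg_nonneg) auto
  have Gsph: "G z \<in> V" if z: "cmod z = r" for z
  proof -
    have z0: "z \<noteq> 0" using z rs by auto
    have "z * cnj z = of_real (r\<^sup>2)" using complex_norm_square[of z] z by simp
    then have "of_real (r\<^sup>2) * cnj (1/z) = z" using z0 by (simp add: field_simps)
    then have "c * cnj (1/z) = b * z" by (simp only: c_def mult.assoc)
    then have "T (G z) = 1/z + (z\<^sup>2 * k z - c * cnj (b * z) - c * cnj (z\<^sup>2 * k z))"
      unfolding T_def G_def complex_cnj_add by (simp add: algebra_simps)
    also have "cmod \<dots> \<le> cmod (1/z) + (cmod (z\<^sup>2 * k z) + cmod (c * cnj (b * z)) + cmod (c * cnj (z\<^sup>2 * k z)))"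
      by (intro order_trans[OF norm_triangle_ineq] add_left_mono order_trans[OF norm_triangle_ineq4] add_right_mono norm_triangle_ineq4)
    also have "\<dots> = 1/r + (r\<^sup>2 * cmod (k z) + cmod b * r\<^sup>2 * (cmod b * r) + cmod b * r\<^sup>2 * (r\<^sup>2 * cmod (k z)))"
      using z c by (simp add: norm_mult norm_divide norm_power)
    also have "\<dots> \<le> 1/r + (r\<^sup>2 * B + cmod b * r\<^sup>2 * (cmod b * 1) + cmod b * r\<^sup>2 * (1 * B))"
      using B[OF z] rs B0 by (intro add_mono mult_mono mult_left_mono order_refl) (auto simp: power_le_one)
    also have "\<dots> = R" by (simp add: R_def algebra_simps power2_eq_square)
    finally show ?thesis by (simp add: V_def)
  qed
  have Ghol: "G holomorphic_on ball 0 1 - {0}"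
    unfolding G_def by (intro holomorphic_intros holomorphic_on_subset[OF k]) auto
  have pole: "filterlim G at_infinity (at 0)"
  proof -
    have "isCont k 0"
      using holomorphic_on_imp_continuous_on[OF k] by (simp add: continuous_on_eq_continuous_at)
    then have "((\<lambda>z. 1 + b * z\<^sup>2 + z^3 * k z) \<longlongrightarrow> 1 + b * 0\<^sup>2 + 0^3 * k 0) (at 0)"
      by (intro tendsto_intros) (simp add: isCont_def)
    then have "filterlim (\<lambda>z. (1 + b * z\<^sup>2 + z^3 * k z) / z) at_infinity (at 0)"
      by (intro filterlim_divide_at_infinity filterlim_ident) auto
    moreover have "eventually (\<lambda>z. (1 + b * z\<^sup>2 + z^3 * k z) / z = G z) (at 0)"
      by (intro eventually_at_topological[THEN iffD2] exI[of _ UNIV])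
         (auto simp: G_def field_simps power2_eq_square power3_eq_cube)
    ultimately show ?thesis by (rule filterlim_cong[THEN iffD1, OF refl refl, rotated])
  qed
  have V: "closed V" "convex V" "bounded V"
  proof -
    show "closed V"
      unfolding V_def by (intro closed_vimage linear_continuous_on linT) auto
    show "convex V"
      unfolding V_def by (intro convex_linear_vimage bounded_linear.linear linT) auto
    have "cmod w \<le> R / (1 - cmod c)" if "w \<in> V" for w
      using that Tlow[of w] c by (simp add: V_def field_simps)
    then show "bounded V" unfolding bounded_iff by blast
  qed
  have GV: "G z \<in> V" if "r < cmod z" "cmod z < 1" for z
    by (rule annulus_image_subset_convex[OF Ghol inj pole V(1,3,2) rs(1) _ _ that]) (use rs Gsph in auto)
  define n where "n = (\<lambda>z. 2 * k z + z * deriv k z)"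
  have nh: "n holomorphic_on ball 0 1" unfolding n_def by (intro holomorphic_intros k) auto
  define l where "l = (\<lambda>z. - 1 / exp z + b * exp z + (exp z)\<^sup>2 * n (exp z))"
  let ?u = "Complex (ln r) 0" and ?v = "Complex (ln s) (2*pi)"
  note low = annulus_integral_lower_bound[OF nh rs l_def]
  \<comment> \<open>On this open rectangle \<open>exp\<close> takes values in the annulus between
    \<open>r\<close> and \<open>s\<close>. It is injective there because imaginary parts differ by
    less than 2 pi.\<close>
  have box: "r < cmod (exp z)" "cmod (exp z) < s" "0 < Im z" "Im z < 2 * pi" if "z \<in> box ?u ?v" for z
    using that rs exp_less_mono[of "ln r" "Re z"] exp_less_mono[of "Re z" "ln s"]
    by (auto simp: in_box_complex_iff)
  have "(1 - (cmod c)\<^sup>2) * integral {Re ?u..Re ?v} (\<lambda>x. integral {Im ?u..Im ?v} (\<lambda>y. (cmod (l (Complex x y)))\<^sup>2))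
    \<le> pi * R\<^sup>2"
  proof (rule integral_rectangle_le_area[where M = "\<lambda>z. T (G (exp z))"])
    show "inj_on (\<lambda>z. T (G (exp z))) (box ?u ?v)"
    proof (rule inj_onI)
      fix z w assume zw: "z \<in> box ?u ?v" "w \<in> box ?u ?v" "T (G (exp z)) = T (G (exp w))"
      have "cmod (exp z) < 1" "cmod (exp w) < 1"
        using box(2)[OF zw(1)] box(2)[OF zw(2)] rs(3) by linarith+
      then have "exp z \<in> ball 0 1 - {0}" "exp w \<in> ball 0 1 - {0}"
        by simp_all
      then have "exp z = exp w" using inj_onD[OF inj Tinj[OF zw(3)]] by blast
      moreover have "\<bar>Im z - Im w\<bar> < 2 * pi"
        using box(3,4)[OF zw(1)] box(3,4)[OF zw(2)] by linarith
      ultimately show "z = w" by (rule exp_complex_eqI[rotated])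
    qed
    show "((\<lambda>z. T (G (exp z))) has_derivative (\<lambda>v. l z * v - c * cnj (l z * v))) (at z)" if z: "z \<in> box ?u ?v" for z
    proof -
      have "cmod (exp z) < 1" using box(2)[OF z] rs(3) by linarith
      then have "exp z \<in> ball 0 1" by simp
      then have "(k has_field_derivative deriv k (exp z)) (at (exp z))"
        using k by (intro holomorphic_derivI) auto
      then have dk: "((\<lambda>z. k (exp z)) has_field_derivative deriv k (exp z) * exp z) (at z)"
        using DERIV_chain2 DERIV_exp by blast
      have "((\<lambda>z. G (exp z)) has_field_derivative l z) (at z)"
        unfolding G_def l_def n_def
        by (rule derivative_eq_intros dk refl | simp)+
           (simp add: field_simps power2_eq_square)
      then have "((\<lambda>z. G (exp z)) has_derivative (\<lambda>v. l z * v)) (at z)"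
        by (simp add: has_field_derivative_def)
      from bounded_linear.has_derivative[OF linT this]
      show ?thesis by (simp add: T_def)
    qed
    show "(\<lambda>z. T (G (exp z))) ` box ?u ?v \<subseteq> cball 0 R"
    proof clarify
      fix z assume "z \<in> box ?u ?v"
      note b = box[OF this]
      have "cmod (exp z) < 1" using b(2) rs(3) by linarith
      then have "G (exp z) \<in> V" using b(1) by (intro GV)
      then show "T (G (exp z)) \<in> cball 0 R" by (simp add: V_def)
    qed
  qed (use c low R0 in auto)
  then have upper: "(1 - (cmod c)\<^sup>2) * integral {ln r..ln s} (\<lambda>x. integral {0..2*pi} (\<lambda>y. (cmod (l (Complex x y)))\<^sup>2)) \<le> pi * R\<^sup>2"
    by (simp only: complex.sel)
  have "(1 - (cmod c)\<^sup>2) * (pi * ((1/r\<^sup>2 - 1/s\<^sup>2) + (cmod b)\<^sup>2 * (s\<^sup>2 - r\<^sup>2))) \<le>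
     (1 - (cmod c)\<^sup>2) * integral {ln r..ln s} (\<lambda>x. integral {0..2*pi} (\<lambda>y. (cmod (l (Complex x y)))\<^sup>2))"
    using c by (intro mult_left_mono low) (auto simp: power_le_one)
  from order_trans[OF this upper]
  have "pi * ((1 - (cmod c)\<^sup>2) * ((1/r\<^sup>2 - 1/s\<^sup>2) + (cmod b)\<^sup>2 * (s\<^sup>2 - r\<^sup>2))) \<le> pi * R\<^sup>2"
    by (simp only: mult.left_commute)
  then have "(1 - (cmod c)\<^sup>2) * ((1/r\<^sup>2 - 1/s\<^sup>2) + (cmod b)\<^sup>2 * (s\<^sup>2 - r\<^sup>2)) \<le> R\<^sup>2"
    using mult_le_cancel_left_pos[OF pi_gt_zero] by blast
  then show ?thesis
    by (simp add: c R_def power_mult_distrib power_mult[symmetric])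
qed

text \<open>For fixed \<open>s\<close> the limit \<open>r \<rightarrow> 0\<close> gives |b|^2 s^4
  \<le> 1; then \<open>s\<close> tends to 1.\<close>

theorem area_theorem_first_coefficient:
  fixes k :: "complex \<Rightarrow> complex" and b :: complex
  assumes k: "k holomorphic_on ball 0 1"
    and inj: "inj_on (\<lambda>z. 1/z + b * z + z\<^sup>2 * k z) (ball 0 1 - {0})"
  shows "cmod b \<le> 1"
proof -
  have s: "(cmod b)\<^sup>2 * s^4 \<le> 1" if s: "0 < s" "s < 1" for s
  proof -
    have "compact (k ` cball 0 s)"
      using s by (intro compact_continuous_image holomorphic_on_imp_continuous_on holomorphic_on_subset[OF k]) auto
    then have "bounded (k ` cball 0 s)" by (rule compact_imp_bounded)
    \<comment> \<open>One bound on the closed disc of radius \<open>s\<close> serves all smaller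
      \<open>r\<close>, so the error constant is independent of \<open>r\<close>.\<close>
    then obtain B where "\<forall>w\<in>k ` cball 0 s. cmod w \<le> B"
      unfolding bounded_iff by blast
    then have B: "cmod (k z) \<le> B" if "cmod z \<le> s" for z
      using that by auto
    \<comment> \<open>For r < d both r < s and |b| r^2 \<le> r (|b| + 1) < 1 hold, as
      \<open>area_inequality\<close> requires.\<close>
    define d where "d = min s (1 / (cmod b + 1))"
    have d: "0 < d" by (auto simp: d_def s add_nonneg_pos)
    show ?thesis
    proof (rule area_limit_bound[OF s(1) d])
      fix r assume r: "0 < r" "r < d"
      have "r * (cmod b + 1) < 1" using r by (simp add: d_def pos_less_divide_eq add_nonneg_pos)
      moreover have "cmod b * r\<^sup>2 \<le> r * (cmod b + 1)"
      proof -
        have "r\<^sup>2 \<le> r" using r s by (simp add: d_def power2_eq_square mult_left_le)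
        then have "cmod b * r\<^sup>2 \<le> cmod b * r" by (intro mult_left_mono) auto
        also have "\<dots> \<le> r * (cmod b + 1)" using r by (simp add: algebra_simps)
        finally show ?thesis .
      qed
      ultimately show "(1 - (cmod b)\<^sup>2 * r^4) * ((1/r\<^sup>2 - 1/s\<^sup>2) + (cmod b)\<^sup>2 * (s\<^sup>2 - r\<^sup>2))
         \<le> (1/r + (B + (cmod b)\<^sup>2 + cmod b * B) * r\<^sup>2)\<^sup>2"
        using r s B by (intro area_inequality[OF k inj]) (auto simp: d_def)
    qed
  qed
  have "((\<lambda>s. (cmod b)\<^sup>2 * s^4) \<longlongrightarrow> (cmod b)\<^sup>2 * 1^4) (at_left 1)"
    by (intro tendsto_intros)
  moreover have "eventually (\<lambda>s::real. (cmod b)\<^sup>2 * s^4 \<le> 1) (at_left 1)"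
    unfolding eventually_at_left_field using s by (intro exI[of _ 0]) auto
  ultimately have "(cmod b)\<^sup>2 * 1^4 \<le> 1"
    by (intro tendsto_upperbound) auto
  then show ?thesis by (simp add: abs_square_le_1)
qed

section \<open>The theorems of Bieberbach and Koebe\<close>

text \<open>\<open>F\<close> is the difference quotient at 0 with its singularity removed. The
  factorisation holds for every \<open>z\<close>, also outside the disc, since it is built into the
  definition. Differentiating \<open>deriv f z = F z + z * deriv F z\<close> at 0 gives the last
  relation.\<close>

lemma holomorphic_first_order_factor:
  assumes f: "f holomorphic_on ball 0 1"
  obtains F where "F holomorphic_on ball 0 1" "\<And>z. f z = f 0 + z * F z"
    "F 0 = deriv f 0" "deriv (deriv f) 0 = 2 * deriv F 0"
proof -
  define F where "F = (\<lambda>z. if z = 0 then deriv f 0 else (f z - f 0) / (z - 0))"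
  have F: "F holomorphic_on ball 0 1"
    unfolding F_def by (rule pole_lemma[OF f]) simp
  have fac: "f z = f 0 + z * F z" for z by (simp add: F_def)
  have dF: "(F has_field_derivative deriv F z) (at z)" if "z \<in> ball 0 1" for z
    using F that by (intro holomorphic_derivI) auto
  have df: "deriv f z = F z + z * deriv F z" if z: "z \<in> ball 0 1" for z
  proof -
    have "((\<lambda>z. f 0 + z * F z) has_field_derivative F z + z * deriv F z) (at z)"
      by (rule derivative_eq_intros dF[OF z] refl | simp)+
    then show ?thesis using fac by (metis (no_types, lifting) DERIV_imp_deriv ext)
  qed
  have ddF: "(deriv F has_field_derivative deriv (deriv F) 0) (at 0)"
    using holomorphic_deriv[OF F] by (intro holomorphic_derivI) auto
  have "((\<lambda>z. F z + z * deriv F z) has_field_derivative 2 * deriv F 0) (at 0)"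
    by (rule derivative_eq_intros dF ddF refl | simp)+
  then have "(deriv f has_field_derivative 2 * deriv F 0) (at 0)"
    by (rule has_field_derivative_transform_within_open[where S = "ball 0 1"]) (auto simp: df)
  then show ?thesis
    using that[OF F fac] by (auto simp: F_def DERIV_imp_deriv)
qed

text \<open>The area theorem is applied to the reciprocal of the odd square root transform
  \<open>z \<mapsto> sqrt (f(z\<^sup>2) - f(0)) = z \<psi>(z\<^sup>2)\<close>.\<close>
theorem bieberbach_second_coefficient:
  assumes f: "univalent_on f (ball 0 1)"
  shows "cmod (deriv (deriv f) 0) \<le> 4 * cmod (deriv f 0)"
proof -
  have fh: "f holomorphic_on ball 0 1" and fi: "inj_on f (ball 0 1)" using f by (auto simp: univalent_on_def)
  have a: "deriv f 0 \<noteq> 0" using holomorphic_injective_imp_regular[OF fh _ fi] by simp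
  obtain F where F: "F holomorphic_on ball 0 1" "\<And>z. f z = f 0 + z * F z"
    "F 0 = deriv f 0" "deriv (deriv f) 0 = 2 * deriv F 0"
    using holomorphic_first_order_factor[OF fh] by metis
  have F0: "F z \<noteq> 0" if "z \<in> ball 0 1" for z
  proof
    assume "F z = 0"
    then have "f z = f 0" using F(2)[of z] by simp
    then have "z = 0" using inj_onD[OF fi _ that, of 0] by simp
    then show False using \<open>F z = 0\<close> F(3) a by simp
  qed
  \<comment> \<open>\<open>F\<close> has no zero, and the disc is contractible.\<close>
  obtain \<psi> where \<psi>: "\<psi> holomorphic_on ball 0 1" "\<And>z. z \<in> ball 0 1 \<Longrightarrow> F z = (\<psi> z)\<^sup>2"
    using contractible_imp_holomorphic_sqrt[OF F(1) _ F0] convex_imp_contractible[OF convex_ball] by metis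
  have \<psi>0: "\<psi> z \<noteq> 0" if "z \<in> ball 0 1" for z using F0[OF that] \<psi>(2)[OF that] by auto
  \<comment> \<open>Normalised to \<open>p 0 = 1\<close>, so that p(z^2)/z, the reciprocal of the
    odd transform up to the factor \<psi>(0), has principal part 1/z.\<close>
  define p where "p = (\<lambda>z. \<psi> 0 / \<psi> z)"
  have ph: "p holomorphic_on ball 0 1" unfolding p_def by (intro holomorphic_intros \<psi> \<psi>0)
  obtain P1 where P1: "P1 holomorphic_on ball 0 1" "\<And>z. p z = p 0 + z * P1 z" "P1 0 = deriv p 0"
    using holomorphic_first_order_factor[OF ph] by metis
  obtain P2 where P2: "P2 holomorphic_on ball 0 1" "\<And>z. P1 z = P1 0 + z * P2 z"
    using holomorphic_first_order_factor[OF P1(1)] by metis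
  have sq: "z\<^sup>2 \<in> ball 0 1" if "z \<in> ball 0 1" for z :: complex
    using that by (simp add: norm_power power_less_one_iff)
  \<comment> \<open>Since p(z^2) is even, p(z^2)/z has only odd powers; after 1/z and the linear
    term the rest is z^3 P2(z^2).\<close>
  define k where "k = (\<lambda>z. z * P2 (z\<^sup>2))"
  have kh: "k holomorphic_on ball 0 1"
    unfolding k_def using sq
    by (intro holomorphic_intros holomorphic_on_compose_gen[OF _ P2(1), unfolded o_def]) auto
  have G: "1/z + deriv p 0 * z + z\<^sup>2 * k z = \<psi> 0 / (z * \<psi> (z\<^sup>2))" if z: "z \<in> ball 0 1 - {0}" for z
  proof -
    have "p (z\<^sup>2) = 1 + z\<^sup>2 * (deriv p 0 + z\<^sup>2 * P2 (z\<^sup>2))"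
      using P1(2)[of "z\<^sup>2"] P2(2)[of "z\<^sup>2"] P1(3) \<psi>0[of 0] by (simp add: p_def)
    then have "p (z\<^sup>2) / z = 1/z + deriv p 0 * z + z\<^sup>2 * k z"
      using z by (simp add: k_def field_simps power2_eq_square)
    then show ?thesis by (simp add: p_def mult.commute)
  qed
  have "inj_on (\<lambda>z. 1/z + deriv p 0 * z + z\<^sup>2 * k z) (ball 0 1 - {0})"
  proof (rule inj_onI)
    fix z w assume z: "z \<in> ball 0 1 - {0}" and w: "w \<in> ball 0 1 - {0}"
      and eq: "1/z + deriv p 0 * z + z\<^sup>2 * k z = 1/w + deriv p 0 * w + w\<^sup>2 * k w"
    have z2: "z\<^sup>2 \<in> ball 0 1" and w2: "w\<^sup>2 \<in> ball 0 1" using z w sq by blast+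
    have "\<psi> 0 / (z * \<psi> (z\<^sup>2)) = \<psi> 0 / (w * \<psi> (w\<^sup>2))" using eq G z w by simp
    then have e: "z * \<psi> (z\<^sup>2) = w * \<psi> (w\<^sup>2)" 
      using z w \<psi>0[of 0] \<psi>0[OF z2] \<psi>0[OF w2] by (simp add: frac_eq_eq)
    then have "z\<^sup>2 * F (z\<^sup>2) = w\<^sup>2 * F (w\<^sup>2)"
      using \<psi>(2)[OF z2] \<psi>(2)[OF w2] by (metis power_mult_distrib)
    then have "f (z\<^sup>2) = f (w\<^sup>2)" using F(2) by metis
    then have "z\<^sup>2 = w\<^sup>2" using inj_onD[OF fi _ z2 w2] by blast
    \<comment> \<open>Equal squares make the \<psi> factors in \<open>e\<close> equal, and these
      cancel; this excludes w = -z.\<close>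
    then show "z = w" using e \<psi>0[OF z2] by simp
  qed
  from area_theorem_first_coefficient[OF kh this] have le: "cmod (deriv p 0) \<le> 1" .
  have d\<psi>: "(\<psi> has_field_derivative deriv \<psi> 0) (at 0)" using \<psi>(1) by (intro holomorphic_derivI) auto
  have "(p has_field_derivative - \<psi> 0 * deriv \<psi> 0 / (\<psi> 0)\<^sup>2) (at 0)"
    unfolding p_def using \<psi>0[of 0] by (auto intro!: derivative_eq_intros d\<psi> simp: power2_eq_square)
  then have dp: "deriv p 0 = - deriv \<psi> 0 / \<psi> 0" using \<psi>0[of 0] by (simp add: DERIV_imp_deriv power2_eq_square)
  have "((\<lambda>z. (\<psi> z)\<^sup>2) has_field_derivative 2 * \<psi> 0 * deriv \<psi> 0) (at 0)"
    by (auto intro!: derivative_eq_intros d\<psi>)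
  then have "(F has_field_derivative 2 * \<psi> 0 * deriv \<psi> 0) (at 0)"
    by (rule has_field_derivative_transform_within_open[where S = "ball 0 1"]) (auto simp: \<psi>(2))
  then have dF: "deriv F 0 = 2 * \<psi> 0 * deriv \<psi> 0" by (rule DERIV_imp_deriv)
  \<comment> \<open>At 0, f''/f' = 2 F'/F = 4 \<psi>'/\<psi> = -4 p'.\<close>
  have "deriv (deriv f) 0 = - 4 * deriv f 0 * deriv p 0"
    using F(3,4) \<psi>(2)[of 0] \<psi>0[of 0] by (simp add: dp dF field_simps power2_eq_square)
  then have "cmod (deriv (deriv f) 0) = 4 * cmod (deriv f 0) * cmod (deriv p 0)" by (simp add: norm_mult)
  also have "\<dots> \<le> 4 * cmod (deriv f 0) * 1" using le by (intro mult_left_mono) auto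
  finally show ?thesis by simp
qed

theorem koebe_quarter_at_0:
  assumes f: "univalent_on f (ball 0 1)"
  shows "ball (f 0) (cmod (deriv f 0) / 4) \<subseteq> f ` ball 0 1"
proof (rule ccontr)
  assume "\<not> ?thesis"
  then obtain w where w: "w \<in> ball (f 0) (cmod (deriv f 0) / 4)" "w \<notin> f ` ball 0 1" by blast
  have fh: "f holomorphic_on ball 0 1" and fi: "inj_on f (ball 0 1)" using f by (auto simp: univalent_on_def)
  have a: "deriv f 0 \<noteq> 0" using holomorphic_injective_imp_regular[OF fh _ fi] by simp
  have nz: "w - f z \<noteq> 0" if "z \<in> ball 0 1" for z using w that by auto
  define g where "g = (\<lambda>z. 1 / (w - f z))"
  have "univalent_on g (ball 0 1)"
    unfolding univalent_on_def
  proof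
    show "g holomorphic_on ball 0 1" unfolding g_def using nz by (intro holomorphic_intros fh) auto
    show "inj_on g (ball 0 1)" unfolding g_def using nz fi by (auto simp: inj_on_def frac_eq_eq)
  qed
  from bieberbach_second_coefficient[OF this] have B: "cmod (deriv (deriv g) 0) \<le> 4 * cmod (deriv g 0)" .
  have df: "(f has_field_derivative deriv f z) (at z)" if "z \<in> ball 0 1" for z
    using fh that by (intro holomorphic_derivI) auto
  have ddf: "(deriv f has_field_derivative deriv (deriv f) 0) (at 0)"
    using holomorphic_deriv[OF fh] by (intro holomorphic_derivI) auto
  have dg: "deriv g z = deriv f z / (w - f z)\<^sup>2" if z: "z \<in> ball 0 1" for z
  proof -
    have "(g has_field_derivative deriv f z / (w - f z)\<^sup>2) (at z)"
      unfolding g_def using nz[OF z]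
      by (auto intro!: derivative_eq_intros df z simp: power2_eq_square)
    then show ?thesis by (rule DERIV_imp_deriv)
  qed
  let ?d = "w - f 0"
  have d0: "?d \<noteq> 0" using nz[of 0] by simp
  have "((\<lambda>z. deriv f z / (w - f z)\<^sup>2) has_field_derivative (deriv (deriv f) 0 + 2 * (deriv f 0)\<^sup>2 / ?d) / ?d\<^sup>2) (at 0)"
  proof -
    have "((\<lambda>z. (w - f z)\<^sup>2) has_field_derivative - (2 * ?d * deriv f 0)) (at 0)"
      by (auto intro!: derivative_eq_intros df)
    from DERIV_divide[OF ddf this]
    have "((\<lambda>z. deriv f z / (w - f z)\<^sup>2) has_field_derivative
       (deriv (deriv f) 0 * ?d\<^sup>2 - deriv f 0 * - (2 * ?d * deriv f 0)) / (?d\<^sup>2 * ?d\<^sup>2)) (at 0)"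
      using d0 by simp
    moreover have id: "(x * d\<^sup>2 - y * - (2 * d * y)) / (d\<^sup>2 * d\<^sup>2) = (x + 2 * y\<^sup>2 / d) / d\<^sup>2" if "d \<noteq> 0" for x y d :: complex
      using that by (simp add: field_simps power2_eq_square)
    ultimately show ?thesis by (simp only: id[OF d0])
  qed
  then have "(deriv g has_field_derivative (deriv (deriv f) 0 + 2 * (deriv f 0)\<^sup>2 / ?d) / ?d\<^sup>2) (at 0)"
    by (rule has_field_derivative_transform_within_open[where S = "ball 0 1"]) (auto simp: dg)
  then have ddg: "deriv (deriv g) 0 = (deriv (deriv f) 0 + 2 * (deriv f 0)\<^sup>2 / ?d) / ?d\<^sup>2" by (rule DERIV_imp_deriv)
  have "cmod (deriv (deriv f) 0 + 2 * (deriv f 0)\<^sup>2 / ?d) / (cmod ?d)\<^sup>2 \<le> 4 * cmod (deriv f 0) / (cmod ?d)\<^sup>2"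
    using B dg[of 0] by (simp add: ddg norm_divide norm_power)
  then have "cmod (deriv (deriv f) 0 + 2 * (deriv f 0)\<^sup>2 / ?d) \<le> 4 * cmod (deriv f 0)"
    using d0 by (simp add: divide_le_cancel)
  moreover have "cmod (2 * (deriv f 0)\<^sup>2 / ?d) \<le> cmod (deriv (deriv f) 0 + 2 * (deriv f 0)\<^sup>2 / ?d) + cmod (deriv (deriv f) 0)"
    using norm_triangle_ineq4[of "deriv (deriv f) 0 + 2 * (deriv f 0)\<^sup>2 / ?d" "deriv (deriv f) 0"] by simp
  ultimately have "2 * (cmod (deriv f 0))\<^sup>2 / cmod ?d \<le> 8 * cmod (deriv f 0)"
    using bieberbach_second_coefficient[OF f] by (simp add: norm_mult norm_divide norm_power)
  then have "cmod (deriv f 0) * (2 * cmod (deriv f 0)) \<le> cmod (deriv f 0) * (8 * cmod ?d)"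
    using d0 by (simp add: field_simps power2_eq_square)
  then have "cmod (deriv f 0) \<le> 4 * cmod ?d" using a by simp
  then show False using w(1) by (simp add: dist_norm norm_minus_commute)
qed

section \<open>Disc automorphisms and the conformal radius\<close>

lemma one_minus_norm_square_pos: "cmod a < 1 \<Longrightarrow> 0 < 1 - (cmod a)\<^sup>2"
  by (simp add: power_less_one_iff abs_square_less_1)

lemma one_minus_cnj_mult_neq_0:
  assumes "cmod a < 1" "cmod z < 1" 
  shows "1 - cnj a * z \<noteq> 0"
proof
  assume "1 - cnj a * z = 0"
  then have "cmod (cnj a * z) = 1" by (metis eq_iff_diff_eq_0 norm_one)
  moreover have "cmod (cnj a * z) < 1 * 1"
    unfolding norm_mult using assms by (intro mult_strict_mono') auto
  ultimately show False by simp
qed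

lemma has_field_derivative_Moebius:
  assumes "cmod a < 1" "cmod z < 1" 
  shows "(Moebius_function 0 a has_field_derivative of_real (1 - (cmod a)\<^sup>2) / (1 - cnj a * z)\<^sup>2) (at z)"
proof -
  have nz: "1 - cnj a * z \<noteq> 0" using assms by (rule one_minus_cnj_mult_neq_0)
  have e: "of_real (1 - (cmod a)\<^sup>2) = 1 - a * cnj a"
    using complex_norm_square[of a] by simp
  show ?thesis
    unfolding Moebius_function_simple[abs_def] e using nz
    by (auto intro!: derivative_eq_intros simp: field_simps power2_eq_square)
qed

text \<open>The Koebe transform: \<open>Moebius_function 0 (- a)\<close> is the disc automorphism (z
  + a)/(1 + cnj(a) z), which sends 0 to \<open>a\<close>. It carries statements about 0 over to any
  point of the disc.\<close>

lemma univalent_on_Moebius: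
  assumes f: "univalent_on f (ball 0 1)" and a: "cmod a < 1"
  defines "g \<equiv> (\<lambda>z. f (Moebius_function 0 (- a) z))"
  shows "univalent_on g (ball 0 1)" and "g ` ball 0 1 = f ` ball 0 1" and "g 0 = f a"
    and "deriv g 0 = deriv f a * (1 - (cmod a)\<^sup>2)"
    and "deriv (deriv g) 0 = (deriv (deriv f) a * (1 - (cmod a)\<^sup>2) - 2 * cnj a * deriv f a) * (1 - (cmod a)\<^sup>2)"
proof -
  let ?T = "Moebius_function 0 (- a)" and ?c = "complex_of_real (1 - (cmod a)\<^sup>2)"
  have fh: "f holomorphic_on ball 0 1" and fi: "inj_on f (ball 0 1)" using f by (auto simp: univalent_on_def)
  have Tm: "?T z \<in> ball 0 1" if "z \<in> ball 0 1" for z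
    using Moebius_function_norm_lt_1[of "-a" z 0] a that by simp
  have TT: "Moebius_function 0 a (?T z) = z" "?T (Moebius_function 0 a z) = z" if "z \<in> ball 0 1" for z
    using Moebius_function_compose[of a "-a" z] Moebius_function_compose[of "-a" a z] that a by auto
  have T0: "?T 0 = a" by (simp add: Moebius_function_of_zero)
  have Th: "?T holomorphic_on ball 0 1" using a by (intro Moebius_function_holomorphic) simp
  have Tim: "?T ` ball 0 1 = ball 0 1"
  proof
    show "ball 0 1 \<subseteq> ?T ` ball 0 1"
    proof
      fix z assume z: "z \<in> ball (0::complex) 1"
      then have "Moebius_function 0 a z \<in> ball 0 1"
        using Moebius_function_norm_lt_1[of a z 0] a by simp
      then show "z \<in> ?T ` ball 0 1" using TT(2)[OF z] by (metis imageI)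
    qed
  qed (use Tm in blast)
  have Ti: "inj_on ?T (ball 0 1)" using TT(1) by (metis inj_on_inverseI)
  show "univalent_on g (ball 0 1)"
    unfolding univalent_on_def g_def
    using holomorphic_on_compose_gen[OF Th fh] comp_inj_on[OF Ti, of f] fi Tim Tm by (auto simp: o_def)
  show "g ` ball 0 1 = f ` ball 0 1" unfolding g_def using Tim by (metis image_image)
  show "g 0 = f a" by (simp add: g_def T0)
  have dT: "(?T has_field_derivative ?c / (1 + cnj a * z)\<^sup>2) (at z)" if "z \<in> ball 0 1" for z
    using has_field_derivative_Moebius[of "-a" z] a that by simp
  have dg: "deriv g z = deriv f (?T z) * (?c / (1 + cnj a * z)\<^sup>2)" if z: "z \<in> ball 0 1" for z
  proof -
    have "(f has_field_derivative deriv f (?T z)) (at (?T z))"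
      using fh Tm[OF z] by (intro holomorphic_derivI) auto
    from DERIV_chain2[OF this dT[OF z]] show ?thesis unfolding g_def by (rule DERIV_imp_deriv)
  qed
  show "deriv g 0 = deriv f a * (1 - (cmod a)\<^sup>2)" using dg[of 0] by (simp add: T0)
  have "(deriv f has_field_derivative deriv (deriv f) (?T 0)) (at (?T 0))"
    using holomorphic_deriv[OF fh] a by (intro holomorphic_derivI[where S="ball 0 1"]) (auto simp: T0)
  from DERIV_chain2[OF this dT[of 0]]
  have d1: "((\<lambda>z. deriv f (?T z)) has_field_derivative deriv (deriv f) a * ?c) (at 0)" by (simp add: T0)
  have d2: "((\<lambda>z. ?c / (1 + cnj a * z)\<^sup>2) has_field_derivative - 2 * cnj a * ?c) (at 0)"
    by (auto intro!: derivative_eq_intros)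
  have "((\<lambda>z. deriv f (?T z) * (?c / (1 + cnj a * z)\<^sup>2)) has_field_derivative
     (deriv (deriv f) a * ?c - 2 * cnj a * deriv f a) * ?c) (at 0)"
    using DERIV_mult[OF d1 d2] by (simp add: T0 algebra_simps)
  then have "(deriv g has_field_derivative (deriv (deriv f) a * ?c - 2 * cnj a * deriv f a) * ?c) (at 0)"
    by (rule has_field_derivative_transform_within_open[where S = "ball 0 1"]) (auto simp: dg)
  then show "deriv (deriv g) 0 = (deriv (deriv f) a * (1 - (cmod a)\<^sup>2) - 2 * cnj a * deriv f a) * (1 - (cmod a)\<^sup>2)"
    by (simp add: DERIV_imp_deriv)
qed

theorem koebe_quarter:
  assumes f: "univalent_on f (ball 0 1)" and a: "cmod a < 1"
  shows "ball (f a) (cmod (deriv f a) * (1 - (cmod a)\<^sup>2) / 4) \<subseteq> f ` ball 0 1"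
proof -
  have "cmod (of_real (1 - (cmod a)\<^sup>2)) = 1 - (cmod a)\<^sup>2"
    using one_minus_norm_square_pos[OF a] unfolding norm_of_real by simp
  then show ?thesis
    using koebe_quarter_at_0[OF univalent_on_Moebius(1)[OF f a]]
    by (simp add: univalent_on_Moebius[OF f a] norm_mult del: of_real_diff)
qed

text \<open>Bieberbach's bound at 0 for the Koebe transform, divided by the positive factor 1 -
  |a|^2. The left side governs the derivative of the conformal radius.\<close>

theorem bieberbach_pre_schwarzian:
  assumes f: "univalent_on f (ball 0 1)" and a: "cmod a < 1"
  shows "cmod (deriv (deriv f) a * (1 - (cmod a)\<^sup>2) - 2 * cnj a * deriv f a) \<le> 4 * cmod (deriv f a)"
proof -
  have p: "0 < 1 - (cmod a)\<^sup>2" using a by (rule one_minus_norm_square_pos)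
  have c: "cmod (of_real (1 - (cmod a)\<^sup>2)) = 1 - (cmod a)\<^sup>2"
    using p unfolding norm_of_real by simp
  have "cmod (deriv (deriv f) a * of_real (1 - (cmod a)\<^sup>2) - 2 * cnj a * deriv f a) * (1 - (cmod a)\<^sup>2)
     \<le> (4 * cmod (deriv f a)) * (1 - (cmod a)\<^sup>2)"
    using bieberbach_second_coefficient[OF univalent_on_Moebius(1)[OF f a]]
    unfolding univalent_on_Moebius(4,5)[OF f a] norm_mult c by simp
  then show ?thesis using p by (simp only: mult_le_cancel_right_pos)
qed

text \<open>Composing \<open>f\<close> with automorphisms that move 0 to \<open>a\<close> and
  \<open>f a\<close> to 0 gives a self-map fixing 0, to which Schwarz's lemma applies; the chain
  rule converts the bound.\<close>

lemma schwarz_pick_deriv: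
  assumes f: "f holomorphic_on ball 0 1" and im: "f ` ball 0 1 \<subseteq> ball 0 1" and a: "cmod a < 1"
  shows "cmod (deriv f a) * (1 - (cmod a)\<^sup>2) \<le> 1 - (cmod (f a))\<^sup>2"
proof -
  let ?T = "Moebius_function 0 (- a)" and ?S = "Moebius_function 0 (f a)"
  have "a \<in> ball 0 1" using a by simp
  then have "f a \<in> ball 0 1" using im by blast
  then have fa: "cmod (f a) < 1" by simp
  have T0: "?T 0 = a" by (simp add: Moebius_function_of_zero)
  define g where "g = (\<lambda>z. ?S (f (?T z)))"
  have Tm: "?T z \<in> ball 0 1" if "z \<in> ball 0 1" for z
    using Moebius_function_norm_lt_1[of "-a" z 0] a that by simp
  have Th: "?T holomorphic_on ball 0 1" using a by (intro Moebius_function_holomorphic) simp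
  have "f \<circ> ?T holomorphic_on ball 0 1" using Tm by (intro holomorphic_on_compose_gen[OF Th f]) auto
  then have gh: "g holomorphic_on ball 0 1"
  proof -
    have "(f \<circ> ?T) ` ball 0 1 \<subseteq> ball 0 1" unfolding image_comp[symmetric] using Tm im by blast
    with \<open>f \<circ> ?T holomorphic_on ball 0 1\<close> have "?S \<circ> (f \<circ> ?T) holomorphic_on ball 0 1"
      by (rule holomorphic_on_compose_gen[OF _ Moebius_function_holomorphic[OF fa]])
    then show ?thesis by (simp add: g_def o_def)
  qed
  have g1: "cmod (g z) < 1" if "cmod z < 1" for z
  proof -
    have "f (?T z) \<in> ball 0 1" using im Tm[of z] that by (simp add: image_subset_iff)
    then show ?thesis unfolding g_def using fa by (intro Moebius_function_norm_lt_1) simp_all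
  qed
  have g0: "g 0 = 0" by (simp add: g_def T0 Moebius_function_eq_zero)
  have "cmod (deriv g 0) \<le> 1" using Schwarz_Lemma[OF gh g0 g1, of 0] by simp
  moreover have "deriv g 0 = deriv f a * (1 - (cmod a)\<^sup>2) / (1 - (cmod (f a))\<^sup>2)"
  proof (rule DERIV_imp_deriv)
    have dT: "(?T has_field_derivative of_real (1 - (cmod a)\<^sup>2)) (at 0)"
      using has_field_derivative_Moebius[of "-a" 0] a by simp
    have "(f has_field_derivative deriv f (?T 0)) (at (?T 0))"
      using f a by (intro holomorphic_derivI[where S="ball 0 1"]) (auto simp: T0)
    from DERIV_chain2[OF this dT]
    have d1: "((\<lambda>z. f (?T z)) has_field_derivative deriv f a * of_real (1 - (cmod a)\<^sup>2)) (at 0)" by (simp add: T0)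
    have "1 - cnj (f a) * f a = of_real (1 - (cmod (f a))\<^sup>2)"
      using complex_norm_square[of "f a"] by (simp add: mult.commute)
    then have "(?S has_field_derivative of_real (1 - (cmod (f a))\<^sup>2) / (of_real (1 - (cmod (f a))\<^sup>2))\<^sup>2) (at (f (?T 0)))"
      using has_field_derivative_Moebius[OF fa fa] by (simp only: T0)
    from DERIV_chain2[OF this d1]
    moreover have "c / c\<^sup>2 * d = d / c" for c d :: complex
      by (simp add: power2_eq_square)
    ultimately show "(g has_field_derivative deriv f a * (1 - (cmod a)\<^sup>2) / (1 - (cmod (f a))\<^sup>2)) (at 0)"
      by (simp only: g_def)
  qed
  ultimately show ?thesis
    using one_minus_norm_square_pos[OF a] one_minus_norm_square_pos[OF fa]
    by (simp add: norm_mult norm_divide divide_le_eq flip: of_real_diff of_real_power)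
qed

section \<open>The Lipschitz estimate for the conformal radius\<close>

definition conformal_radius_at :: "(complex \<Rightarrow> complex) \<Rightarrow> complex \<Rightarrow> real" where
  "conformal_radius_at h z = cmod (deriv h z) * (1 - (cmod z)\<^sup>2)"

text \<open>The segment in the image is pulled back to the disc, and the mean value theorem is
  applied to the conformal radius along the resulting curve. Only the lower estimate is
  needed.\<close>

lemma conformal_radius_lipschitz:
  assumes h: "univalent_on h (ball 0 1)" and a: "cmod a < 1" and z: "cmod z < 1"
    and seg: "closed_segment (h a) (h z) \<subseteq> h ` ball 0 1"
  shows "conformal_radius_at h a - 4 * dist (h a) (h z) \<le> conformal_radius_at h z"
proof -
  have hh: "h holomorphic_on ball 0 1" and hi: "inj_on h (ball 0 1)" using h by (auto simp: univalent_on_def)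
  obtain F where F: "F holomorphic_on h ` ball 0 1" "\<And>z. z \<in> ball 0 1 \<Longrightarrow> deriv h z * deriv F (h z) = 1"
     "\<And>z. z \<in> ball 0 1 \<Longrightarrow> F (h z) = z"
    using holomorphic_has_inverse[OF hh open_ball hi] by metis
  have op: "open (h ` ball 0 1)" by (rule open_mapping_thm3[OF hh open_ball hi])
  define v where "v = h z - h a"
  define \<gamma> where "\<gamma> = (\<lambda>t. F (h a + of_real t * v))"
  define u where "u = (\<lambda>t. conformal_radius_at h (\<gamma> t))"
  have mem: "h a + of_real t * v \<in> h ` ball 0 1" if "0 \<le> t" "t \<le> 1" for t
  proof -
    have "h a + of_real t * v = (1 - t) *\<^sub>R h a + t *\<^sub>R h z"
      by (simp add: v_def scaleR_conv_of_real algebra_simps)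
    then have "h a + of_real t * v \<in> closed_segment (h a) (h z)" using that by (auto simp: in_segment)
    then show ?thesis using seg by blast
  qed
  have \<gamma>m: "\<gamma> t \<in> ball 0 1" if "0 \<le> t" "t \<le> 1" for t
    using mem[OF that] F(3) by (auto simp: \<gamma>_def)
  have ends: "\<gamma> 0 = a" "\<gamma> 1 = z" using F(3) a z by (auto simp: \<gamma>_def v_def)
  have "\<exists>D. (u has_real_derivative D) (at t) \<and> \<bar>D\<bar> \<le> 4 * cmod v" if t: "0 \<le> t" "t \<le> 1" for t
  proof -
    let ?z = "\<gamma> t"
    have zm: "?z \<in> ball 0 1" "cmod ?z < 1" using \<gamma>m[OF t] by auto
    have hz: "h ?z = h a + of_real t * v" using mem[OF t] F(3) by (auto simp: \<gamma>_def)
    have h0: "deriv h ?z \<noteq> 0" using F(2)[OF zm(1)] by auto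
    \<comment> \<open>The velocity of \<open>\<gamma>\<close> at \<open>t\<close>, by the chain rule
      for the inverse \<open>F\<close>.\<close>
    define w where "w = v / deriv h ?z"
    have "(F has_field_derivative deriv F (h ?z)) (at (h a + of_real t * v))"
      using mem[OF t] op F(1) hz by (metis holomorphic_derivI)
    moreover have "deriv F (h ?z) = 1 / deriv h ?z"
      using F(2)[OF zm(1)] h0 by (simp add: field_simps)
    ultimately have "(F has_field_derivative 1 / deriv h ?z) (at (h a + of_real t * v))"
      by (simp only:)
    moreover have "((\<lambda>t. h a + of_real t * v) has_vector_derivative v) (at t)"
      by (auto intro!: derivative_eq_intros)
    ultimately have "(\<gamma> has_vector_derivative w) (at t)"
      using field_vector_diff_chain_at[of "\<lambda>t. h a + of_real t * v" v t F "1 / deriv h ?z"]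
      by (simp add: \<gamma>_def w_def o_def)
    then have d\<gamma>: "(\<gamma> has_derivative (\<lambda>s. of_real s * w)) (at t)"
      by (simp add: has_vector_derivative_def scaleR_conv_of_real)
    have "(deriv h has_field_derivative deriv (deriv h) ?z) (at ?z)"
      using holomorphic_deriv[OF hh] zm by (intro holomorphic_derivI[where S="ball 0 1"]) auto
    then have "(deriv h has_derivative (\<lambda>x. deriv (deriv h) ?z * x)) (at ?z)"
      by (simp add: has_field_derivative_def)
    from has_derivative_compose[OF d\<gamma> this]
    have dh: "((\<lambda>t. deriv h (\<gamma> t)) has_derivative (\<lambda>s. deriv (deriv h) ?z * (of_real s * w))) (at t)" .
    have d1: "((\<lambda>t. cmod (deriv h (\<gamma> t))) has_derivative (\<lambda>s. inner (deriv (deriv h) ?z * (of_real s * w)) (sgn (deriv h ?z)))) (at t)"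
      using has_derivative_compose[OF dh has_derivative_norm[OF h0]] by simp
    have d2: "((\<lambda>t. 1 - (cmod (\<gamma> t))\<^sup>2) has_derivative (\<lambda>s. - (2 * inner ?z (of_real s * w)))) (at t)"
      unfolding power2_norm_eq_inner
      by (rule derivative_eq_intros d\<gamma> refl | simp add: inner_commute)+
    \<comment> \<open>The product rule writes the derivative of |h'| (1 - |z|^2) in direction
      \<open>w\<close> as the real inner product of \<open>q\<close> with the unit vector of h'. The
      first factor of \<open>q\<close> is what \<open>bieberbach_pre_schwarzian\<close>
      bounds.\<close>
    define q where "q = (deriv (deriv h) ?z * (1 - (cmod ?z)\<^sup>2) - 2 * cnj ?z * deriv h ?z) * w"
    have "(u has_derivative (\<lambda>s. s * inner q (sgn (deriv h ?z)))) (at t)"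
      unfolding u_def conformal_radius_at_def
    proof (rule has_derivative_eq_rhs[OF has_derivative_mult[OF d1 d2]], rule ext)
      fix s
      have n: "deriv h ?z = of_real (cmod (deriv h ?z)) * sgn (deriv h ?z)"
        using h0 by (simp add: sgn_eq)
      \<comment> \<open>Multiplication by a number of modulus 1 preserves inner products.\<close>
      have sg: "inner (x * sgn (deriv h ?z)) (sgn (deriv h ?z)) = Re x" for x
      proof -
        have "(cmod (sgn (deriv h ?z)))\<^sup>2 = 1" using h0 by (simp add: norm_sgn)
        then show ?thesis by (simp add: inner_complex_def cmod_power2) algebra
      qed
      have "inner (2 * cnj ?z * deriv h ?z * w) (sgn (deriv h ?z)) = 2 * cmod (deriv h ?z) * inner ?z w"
      proof -
        have "2 * cnj ?z * deriv h ?z * w = (2 * of_real (cmod (deriv h ?z)) * cnj ?z * w) * sgn (deriv h ?z)"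
          by (subst n) (simp add: mult_ac)
        then have "inner (2 * cnj ?z * deriv h ?z * w) (sgn (deriv h ?z)) = Re (2 * of_real (cmod (deriv h ?z)) * cnj ?z * w)"
          by (simp only: sg)
        then show ?thesis by (simp add: inner_complex_def algebra_simps)
      qed
      moreover have "q = (1 - (cmod ?z)\<^sup>2) *\<^sub>R (deriv (deriv h) ?z * w) - 2 * cnj ?z * deriv h ?z * w"
        by (simp add: q_def scaleR_conv_of_real algebra_simps)
      ultimately have q: "inner q (sgn (deriv h ?z)) = (1 - (cmod ?z)\<^sup>2) * inner (deriv (deriv h) ?z * w) (sgn (deriv h ?z)) - 2 * cmod (deriv h ?z) * inner ?z w"
        by (simp add: inner_diff_left)
      have s: "deriv (deriv h) ?z * (of_real s * w) = s *\<^sub>R (deriv (deriv h) ?z * w)" "of_real s * w = s *\<^sub>R w"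
        by (simp_all add: scaleR_conv_of_real)
      show "cmod (deriv h ?z) * - (2 * inner ?z (of_real s * w)) + inner (deriv (deriv h) ?z * (of_real s * w)) (sgn (deriv h ?z)) * (1 - (cmod ?z)\<^sup>2)
         = s * inner q (sgn (deriv h ?z))"
        unfolding q s by (simp add: algebra_simps)
    qed
    then have "(u has_real_derivative inner q (sgn (deriv h ?z))) (at t)"
      by (simp add: has_field_derivative_def mult.commute[of _ "inner q _"] mult_commute_abs)
    moreover have "\<bar>inner q (sgn (deriv h ?z))\<bar> \<le> 4 * cmod v"
    proof -
      have "\<bar>inner q (sgn (deriv h ?z))\<bar> \<le> cmod q * cmod (sgn (deriv h ?z))" by (rule Cauchy_Schwarz_ineq2)
      also have "\<dots> = cmod q" using h0 by (simp add: norm_sgn)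
      also have "\<dots> \<le> 4 * cmod (deriv h ?z) * cmod w"
        unfolding q_def norm_mult[of _ w] using bieberbach_pre_schwarzian[OF h zm(2)]
        by (intro mult_right_mono) auto
      also have "\<dots> = 4 * cmod v" using h0 by (simp add: w_def norm_divide)
      finally show ?thesis .
    qed
    ultimately show ?thesis by blast
  qed
  then obtain D where D: "\<And>t. 0 \<le> t \<Longrightarrow> t \<le> 1 \<Longrightarrow> (u has_real_derivative D t) (at t)"
     "\<And>t. 0 \<le> t \<Longrightarrow> t \<le> 1 \<Longrightarrow> \<bar>D t\<bar> \<le> 4 * cmod v"
    by metis
  obtain t where t: "0 < t" "t < 1" "u 1 - u 0 = (1 - 0) * D t"
    using MVT2[of 0 1 u D] D(1) by auto
  then have "u 0 - u 1 \<le> 4 * cmod v" using D(2)[of t] by auto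
  then show ?thesis by (simp add: u_def ends v_def dist_norm norm_minus_commute)
qed

section \<open>The covering theorem\<close>

theorem theorem2:
  fixes \<alpha> :: real and \<beta> :: complex and h :: "complex \<Rightarrow> complex" and x\<^sub>0 x\<^sub>1 :: complex
  assumes "0 < \<alpha>" and "\<alpha> < cmod \<beta>" and "cmod \<beta> < 1"
    and "univalent_on h unit_disk"
    and "(\<lambda>w. \<beta> * w) ` h ` unit_disk \<subseteq> h ` unit_disk"
    and "x\<^sub>0 \<in> unit_disk"
    and "x\<^sub>1 = the_inv_into unit_disk h (\<beta> * h x\<^sub>0)"
  shows "x\<^sub>1 \<in> unit_disk \<and> h x\<^sub>1 = \<beta> * h x\<^sub>0 \<and>
    ball (h x\<^sub>1) ((cmod \<beta> - \<alpha>) / (4 * cmod \<beta>) * cmod (deriv h x\<^sub>1) * (1 - (cmod x\<^sub>1)\<^sup>2))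
      \<subseteq> h ` Omega h x\<^sub>0 \<alpha> \<and>
    (cmod \<beta> - \<alpha>) / (4 * cmod \<beta>) * cmod (deriv h x\<^sub>1) * (1 - (cmod x\<^sub>1)\<^sup>2)
      \<ge> (cmod \<beta> - \<alpha>) / 4 * cmod (deriv h x\<^sub>0) * (1 - (cmod x\<^sub>0)\<^sup>2)"
proof -
  let ?b = "cmod \<beta>"
  have b: "?b > 0" using assms by linarith
  have hh: "h holomorphic_on ball 0 1" and hi: "inj_on h (ball 0 1)" using assms(4) by (auto simp: univalent_on_def)
  have m0: "\<beta> * h x\<^sub>0 \<in> h ` unit_disk" using assms(5,6) by blast
  have x1: "x\<^sub>1 \<in> unit_disk" unfolding assms(7) using the_inv_into_into[OF hi m0 subset_refl] .
  have hx1: "h x\<^sub>1 = \<beta> * h x\<^sub>0" unfolding assms(7) using f_the_inv_into_f[OF hi m0] .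
  obtain F where F: "F holomorphic_on h ` ball 0 1" "\<And>z. z \<in> ball 0 1 \<Longrightarrow> deriv h z * deriv F (h z) = 1"
     "\<And>z. z \<in> ball 0 1 \<Longrightarrow> F (h z) = z"
    using holomorphic_has_inverse[OF hh open_ball hi] by metis
  \<comment> \<open>The self-map of the disc conjugate under \<open>h\<close> to multiplication by
    \<beta>; it sends \<open>x\<^sub>0\<close> to \<open>x\<^sub>1\<close>.\<close>
  define \<phi> where "\<phi> = (\<lambda>z. F (\<beta> * h z))"
  have \<phi>h: "\<phi> holomorphic_on ball 0 1"
  proof -
    have "(\<lambda>z. \<beta> * h z) holomorphic_on ball 0 1" by (intro holomorphic_intros hh)
    moreover have "(\<lambda>z. \<beta> * h z) ` ball 0 1 \<subseteq> h ` ball 0 1" using assms(5) by (simp only: image_image)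
    ultimately have "F \<circ> (\<lambda>z. \<beta> * h z) holomorphic_on ball 0 1"
      by (rule holomorphic_on_compose_gen[OF _ F(1)])
    then show ?thesis by (simp add: \<phi>_def o_def)
  qed
  have \<phi>m: "\<phi> z \<in> ball 0 1" "h (\<phi> z) = \<beta> * h z" if "z \<in> ball 0 1" for z
  proof -
    have "\<beta> * h z \<in> (\<lambda>w. \<beta> * w) ` h ` ball 0 1" using that by (intro imageI)
    then have "\<beta> * h z \<in> h ` ball 0 1" using assms(5) by (rule rev_subsetD)
    then obtain y where "y \<in> ball 0 1" "\<beta> * h z = h y" by (elim imageE)
    then show "\<phi> z \<in> ball 0 1" "h (\<phi> z) = \<beta> * h z" by (auto simp: \<phi>_def F(3))
  qed
  have \<phi>0: "\<phi> x\<^sub>0 = x\<^sub>1" using F(3)[OF x1] hx1 by (simp add: \<phi>_def)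
  \<comment> \<open>Differentiate \<open>h (\<phi> z) = \<beta> * h z\<close> at
    \<open>x\<^sub>0\<close>.\<close>
  have "deriv h x\<^sub>1 * deriv \<phi> x\<^sub>0 = \<beta> * deriv h x\<^sub>0"
  proof -
    have d: "(\<phi> has_field_derivative deriv \<phi> x\<^sub>0) (at x\<^sub>0)" "(h has_field_derivative deriv h x\<^sub>0) (at x\<^sub>0)"
      "(h has_field_derivative deriv h x\<^sub>1) (at (\<phi> x\<^sub>0))"
      using \<phi>h hh assms(6) x1 \<phi>0 by (auto intro: holomorphic_derivI)
    have "((\<lambda>z. h (\<phi> z)) has_field_derivative deriv h x\<^sub>1 * deriv \<phi> x\<^sub>0) (at x\<^sub>0)"
      by (rule DERIV_chain2[OF d(3,1)])
    moreover have "((\<lambda>z. h (\<phi> z)) has_field_derivative \<beta> * deriv h x\<^sub>0) (at x\<^sub>0)"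
      by (rule has_field_derivative_transform_within_open[OF DERIV_cmult[OF d(2)] open_ball assms(6)])
         (auto simp: \<phi>m)
    ultimately show ?thesis by (rule DERIV_unique)
  qed
  then have "cmod (deriv h x\<^sub>1) * cmod (deriv \<phi> x\<^sub>0) = ?b * cmod (deriv h x\<^sub>0)" by (metis norm_mult)
  moreover have "cmod (deriv \<phi> x\<^sub>0) * (1 - (cmod x\<^sub>0)\<^sup>2) \<le> 1 - (cmod x\<^sub>1)\<^sup>2"
  proof -
    have "\<phi> ` ball 0 1 \<subseteq> ball 0 1" using \<phi>m(1) by blast
    from schwarz_pick_deriv[OF \<phi>h this, of x\<^sub>0] show ?thesis using assms(6) \<phi>0 by simp
  qed
  then have "cmod (deriv h x\<^sub>1) * (cmod (deriv \<phi> x\<^sub>0) * (1 - (cmod x\<^sub>0)\<^sup>2)) \<le> conformal_radius_at h x\<^sub>1"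
    unfolding conformal_radius_at_def by (intro mult_left_mono) auto
  ultimately have \<rho>: "?b * conformal_radius_at h x\<^sub>0 \<le> conformal_radius_at h x\<^sub>1"
    by (simp add: conformal_radius_at_def mult.assoc[symmetric])
  let ?r = "(?b - \<alpha>) / (4 * ?b) * conformal_radius_at h x\<^sub>1"
  have \<rho>1: "0 \<le> conformal_radius_at h x\<^sub>1"
    using one_minus_norm_square_pos[of x\<^sub>1] x1 by (simp add: conformal_radius_at_def)
  have rad: "(?b - \<alpha>) / 4 * conformal_radius_at h x\<^sub>0 \<le> ?r"
  proof -
    have "(?b - \<alpha>) / (4 * ?b) * (?b * conformal_radius_at h x\<^sub>0) \<le> ?r"
      using assms b by (intro mult_left_mono \<rho>) auto
    then show ?thesis using b by simp
  qed
  have "ball (h x\<^sub>1) ?r \<subseteq> h ` Omega h x\<^sub>0 \<alpha>"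
  proof
    fix w assume w: "w \<in> ball (h x\<^sub>1) ?r"
    \<comment> \<open>This keeps the ball inside the disc supplied by Koebe's theorem, so its points
      and the segments to its centre lie in the image of \<open>h\<close>.\<close>
    have "?r \<le> conformal_radius_at h x\<^sub>1 / 4"
    proof -
      have "(?b - \<alpha>) / (4 * ?b) \<le> 1 / 4" using b assms(1) by (simp add: field_simps)
      from mult_right_mono[OF this \<rho>1] show ?thesis by simp
    qed
    then have sub: "ball (h x\<^sub>1) ?r \<subseteq> h ` ball 0 1"
      using koebe_quarter[OF assms(4), of x\<^sub>1] x1 subset_ball unfolding conformal_radius_at_def by fastforce
    then obtain z where z: "z \<in> ball 0 1" "w = h z" using w by blast
    have "closed_segment (h x\<^sub>1) (h z) \<subseteq> ball (h x\<^sub>1) ?r"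
      using w z by (intro closed_segment_subset convex_ball) (auto intro: le_less_trans[OF zero_le_dist])
    then have "conformal_radius_at h x\<^sub>1 - 4 * dist (h x\<^sub>1) (h z) \<le> conformal_radius_at h z"
      using conformal_radius_lipschitz[OF assms(4), of x\<^sub>1 z] sub x1 z by auto
    moreover have "dist (h x\<^sub>1) (h z) < ?r" using w z by simp
    \<comment> \<open>The factor in the radius is chosen so that a Lipschitz loss of 4r leaves
      exactly the fraction \<alpha>/|\<beta>| of the conformal radius at
      \<open>x\<^sub>1\<close>.\<close>
    moreover have "4 * ?r = conformal_radius_at h x\<^sub>1 - \<alpha> / ?b * conformal_radius_at h x\<^sub>1"
      using b by (simp add: field_simps)
    moreover have "\<alpha> * conformal_radius_at h x\<^sub>0 \<le> \<alpha> / ?b * conformal_radius_at h x\<^sub>1"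
    proof -
      have "\<alpha> / ?b * (?b * conformal_radius_at h x\<^sub>0) \<le> \<alpha> / ?b * conformal_radius_at h x\<^sub>1"
        using b assms(1) by (intro mult_left_mono \<rho>) auto
      then show ?thesis using b by simp
    qed
    ultimately have "\<alpha> * conformal_radius_at h x\<^sub>0 < conformal_radius_at h z" by linarith
    then show "w \<in> h ` Omega h x\<^sub>0 \<alpha>"
      using z by (auto simp: Omega_def conformal_radius_at_def mult.assoc)
  qed
  then show ?thesis
    using x1 hx1 rad by (simp add: conformal_radius_at_def mult.assoc)
qed

end
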